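(* Let $K\subset\mathbb{R}^n$ be an $n$-simplex and let $L_1,\dots,L_n$ be convex bodies in $\mathbb{R}^n$. Then $$V(L_1,\dots,L_{n})\,V_n(K)\leq V(L_1,K[n-1])\,V(L_2,\dots,L_{n},K).$$
   Context: A convex body in $\mathbb{R}^n$ is a convex compact set with non-empty interior. An $n$-simplex is the convex hull of $n+1$ affinely independent points. $V_n$ denotes $n$-dimensional Euclidean volume. $V(K_1,\dots,K_n)$ denotes the ($n$-dimensional) mixed volume of compact convex sets, i.e. the symmetric function, multilinear with respect to Minkowski addition and non-negative scaling, satisfying $V_n(\lambda_1K_1+\dots+\lambda_nK_n)=\sum_{i_1,\dots,i_n=1}^n\lambda_{i_1}\cdots\lambda_{i_n}V(K_{i_1},\dots,K_{i_n})$ for $\lambda_i\ge 0$; in particular $V(K,\dots,K)=V_n(K)$. The notation $K[m]$ means that $K$ is repeated $m$ times. *)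

theory Defs
  imports "HOL-Analysis.Analysis" "HOL-Library.Set_Algebras" "HOL-Library.Multiset"
begin

definition convex_body :: "(real^'n) set \<Rightarrow> bool" where
  "convex_body K \<longleftrightarrow> convex K \<and> compact K \<and> interior K \<noteq> {}"

(* The domain of the mixed volume: n-tuples, as lists of length n, of compact convex sets in R^n.
   Nonemptiness is needed: K + {} = {} would contradict additivity in each argument. *)
definition compact_convex_tuples :: "(real^'n) set list set" where
  "compact_convex_tuples =
     {Ks. length Ks = CARD('n) \<and> (\<forall>K\<in>set Ks. convex K \<and> compact K \<and> K \<noteq> {})}"

(* Both + and the sum of sets are Minkowski addition (Set_Algebras). *)
definition mixed_volume_functional :: "((real^'n) set list \<Rightarrow> real) \<Rightarrow> bool" where
  "mixed_volume_functional V \<longleftrightarrow>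
     (\<forall>Ks\<in>compact_convex_tuples. \<forall>Ks'. mset Ks' = mset Ks \<longrightarrow> V Ks' = V Ks) \<and>
     (\<forall>Ks K M Ks' a b.
        Ks @ [K] @ Ks' \<in> compact_convex_tuples \<longrightarrow> Ks @ [M] @ Ks' \<in> compact_convex_tuples \<longrightarrow>
        a \<ge> 0 \<longrightarrow> b \<ge> 0 \<longrightarrow>
        V (Ks @ [(*\<^sub>R) a ` K + (*\<^sub>R) b ` M] @ Ks') =
          a * V (Ks @ [K] @ Ks') + b * V (Ks @ [M] @ Ks')) \<and>
     (\<forall>Ks\<in>compact_convex_tuples. \<forall>c :: nat \<Rightarrow> real. (\<forall>i<CARD('n). c i \<ge> 0) \<longrightarrow>
        measure lebesgue (\<Sum>i<CARD('n). (*\<^sub>R) (c i) ` (Ks ! i)) =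
        (\<Sum>is | length is = CARD('n) \<and> set is \<subseteq> {..<CARD('n)}.
           (\<Prod>j<CARD('n). c (is ! j)) * V (map ((!) Ks) is)))"

(* The functional exists (Minkowski) and its values on compact_convex_tuples are unique
   (polarization), but it is arbitrary elsewhere; hence the description of the value
   rather than of the functional. *)
definition mixed_volume :: "(real^'n) set list \<Rightarrow> real" where
  "mixed_volume Ks = (THE v. \<exists>V. mixed_volume_functional V \<and> V Ks = v)"

end

theory Submission
  imports Defs
begin

text \<open>
  Write V for the mixed volume in \<real>^n and let t K + y be the smallest homothetic copy of the
  simplex K that contains L_1. A simplex has n + 1 facets, as many as there are parameters in
  (t, y), so this copy can be chosen to touch L_1 in every facet (circumscribed_homothet). The mixed
  volume is monotone and linear in each argument and vanishes when one argument is a point, so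
  V(L_1, L_2, ..., L_n) \<le> t V(K, L_2, ..., L_n). The theorem follows once t V(K, ..., K) \<le> V(L_1, K[n-1])
  is known (circumscribed_mixed_vol_ge). For this, n V(L_1, K[n-1]) is the derivative at 0 of the
  volume of K + \<epsilon> L_1. This body contains the translates K + \<epsilon> q, one for each point q where L_1
  touches a facet of t K + y. They cover the simplex (1 + \<epsilon> t) K + \<epsilon> y up to points within
  distance O(\<epsilon>) of two facets at once; these have volume O(\<epsilon>^2), while the simplex itself has volume
  (1 + \<epsilon> t)^n V(K, ..., K).

  Most of the text establishes the mixed volume and its monotonicity. Both come from an idea of
  Gromov: attach to a compact convex set K a convex function \<phi> (a potential) which grows like the
  support function of K. Its gradient maps \<real>^n into K and attains every interior point of K, so the change
  of variables formula gives the volume of K as the integral of det D^2 \<phi> (potential_det_integral).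
  Potentials add when sets are added, and the determinant of a combination of matrices is a
  polynomial in its coefficients. Hence the volume of a Minkowski combination is a polynomial too,
  and the mixed volume is the integral of the mixed discriminant of the Hessians
  (mixed_vol_integral). From this representation multilinearity is read off pointwise. For
  monotonicity, let L be contained in M, with potentials u and v. For every \<epsilon> > 0 the function
  ln (exp u + \<epsilon> exp v) is a potential of the larger set M, but its Hessian tends to that of u as
  \<epsilon> tends to 0. Mixed discriminants of positive semidefinite matrices are nonnegative, so Fatou's
  lemma gives mixed_vol_mono.
\<close>

section \<open>Inclusion and exclusion over supports\<close>

text \<open>
  Unless B is all of I, adding or removing a fixed element of I - B pairs the supersets of B so that
  the two members of each pair cancel.
\<close>
lemma alternating_sum_supersets:
  assumes "finite I" "B \<subseteq> I"
  shows "(\<Sum>S | B \<subseteq> S \<and> S \<subseteq> I. (- 1) ^ (card I - card S)) = (if B = I then 1 else (0::real))"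
proof (cases "B = I")
  case True
  then have "{S. B \<subseteq> S \<and> S \<subseteq> I} = {I}" by auto
  then show ?thesis using True by simp
next
  case False
  then obtain a where a: "a \<in> I" "a \<notin> B" using assms(2) by blast
  define P where "P = {S. B \<subseteq> S \<and> S \<subseteq> I - {a}}"
  have fP: "finite P" unfolding P_def by (rule finite_subset[of _ "Pow I"]) (use assms in auto)
  have eq: "{S. B \<subseteq> S \<and> S \<subseteq> I} = P \<union> insert a ` P"
  proof (intro set_eqI iffI)
    fix S assume S: "S \<in> {S. B \<subseteq> S \<and> S \<subseteq> I}"
    show "S \<in> P \<union> insert a ` P"
    proof (cases "a \<in> S")
      case True
      then have "S = insert a (S - {a})" "S - {a} \<in> P" using S a unfolding P_def by auto
      then show ?thesis by blast
    next
      case False then show ?thesis using S unfolding P_def by auto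
    qed
  qed (use a in \<open>auto simp: P_def\<close>)
  have inj: "inj_on (insert a) P"
    unfolding P_def inj_on_def by auto
  have "(\<Sum>S | B \<subseteq> S \<and> S \<subseteq> I. (- 1) ^ (card I - card S)) =
      (\<Sum>S\<in>P. (- 1) ^ (card I - card S)) + (\<Sum>S\<in>insert a ` P. (- 1) ^ (card I - card S) :: real)"
    unfolding eq by (rule sum.union_disjoint) (use fP in \<open>auto simp: P_def\<close>)
  also have "(\<Sum>S\<in>insert a ` P. (- 1) ^ (card I - card S) :: real) =
      (\<Sum>S\<in>P. - ((- 1) ^ (card I - card S)))"
    unfolding sum.reindex[OF inj] comp_def
  proof (rule sum.cong[OF refl])
    fix S assume "S \<in> P"
    then have S: "S \<subseteq> I" "a \<notin> S" "finite S" using finite_subset assms(1) unfolding P_def by auto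
    then have "S \<subset> I" using a by auto
    then have lt: "card S < card I" using assms(1) psubset_card_mono by blast
    have "card (insert a S) = Suc (card S)" using S by simp
    then have "card I - card S = Suc (card I - card (insert a S))" using lt by simp
    then show "(- 1) ^ (card I - card (insert a S)) = - ((- 1) ^ (card I - card S) :: real)" by simp
  qed
  finally show ?thesis using False by (simp add: sum_negf)
qed

text \<open>
  Serves twice, each time to recover the coefficient of a product of n distinct variables from the
  values of a polynomial at 0-1 vectors: for the mixed discriminant in terms of determinants, where
  the support is the range of a function, and for the mixed volume in terms of volumes, where it is
  the set of entries of a list.
\<close>
lemma inclusion_exclusion_support:
  fixes X :: "'f \<Rightarrow> real"
  assumes "finite I" "finite T" "\<And>f. f \<in> T \<Longrightarrow> supp f \<subseteq> I"
  shows "(\<Sum>S\<in>Pow I. (- 1) ^ (card I - card S) * (\<Sum>f | f \<in> T \<and> supp f \<subseteq> S. X f))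
     = (\<Sum>f | f \<in> T \<and> supp f = I. X f)"
proof -
  have "(\<Sum>S\<in>Pow I. (- 1) ^ (card I - card S) * (\<Sum>f | f \<in> T \<and> supp f \<subseteq> S. X f))
     = (\<Sum>S\<in>Pow I. \<Sum>f\<in>T. if supp f \<subseteq> S then (- 1) ^ (card I - card S) * X f else 0)"
    by (simp add: sum_distrib_left sum.inter_filter[symmetric] assms Collect_conj_eq[symmetric])
  also have "\<dots> = (\<Sum>f\<in>T. \<Sum>S\<in>Pow I. if supp f \<subseteq> S then (- 1) ^ (card I - card S) * X f else 0)"
    by (rule sum.swap)
  also have "\<dots> = (\<Sum>f\<in>T. if supp f = I then X f else 0)"
  proof (rule sum.cong[OF refl])
    fix f assume "f \<in> T"
    have "(\<Sum>S\<in>Pow I. if supp f \<subseteq> S then (- 1) ^ (card I - card S) * X f else 0)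
        = (\<Sum>S | supp f \<subseteq> S \<and> S \<subseteq> I. (- 1) ^ (card I - card S) * X f)"
    proof -
      have "{S \<in> Pow I. supp f \<subseteq> S} = {S. supp f \<subseteq> S \<and> S \<subseteq> I}" by auto
      then show ?thesis using assms(1) by (simp add: sum.inter_filter[symmetric])
    qed
    also have "\<dots> = (if supp f = I then 1 else 0) * X f"
      unfolding sum_distrib_right[symmetric] alternating_sum_supersets[OF assms(1) assms(3)[OF \<open>f \<in> T\<close>]] ..
    finally show "(\<Sum>S\<in>Pow I. if supp f \<subseteq> S then (- 1) ^ (card I - card S) * X f else 0)
        = (if supp f = I then X f else 0)" by simp
  qed
  also have "\<dots> = (\<Sum>f | f \<in> T \<and> supp f = I. X f)"
    using assms(2) by (simp add: sum.inter_filter[symmetric])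
  finally show ?thesis .
qed

section \<open>Mixed discriminants\<close>

text \<open>
  The mixed discriminant, n! times its usual normalisation: the polarisation of the determinant. Row i
  is taken from the matrix that the permutation assigns to i. The matrices are indexed by the type
  that also indexes the rows, so that no bijection between two index sets is needed.
\<close>
definition mixed_disc :: "('n::finite \<Rightarrow> real^'n^'n) \<Rightarrow> real" where
  "mixed_disc A = (\<Sum>p | p permutes (UNIV :: 'n set). det (\<chi> i. A (p i) $ i))"

lemma det_sum_scaleR:
  fixes A :: "'n::finite \<Rightarrow> real^'n^'n"
  shows "det (\<Sum>k\<in>S. c k *\<^sub>R A k) =
    (\<Sum>f | range f \<subseteq> S. (\<Prod>i\<in>UNIV. c (f i)) * det (\<chi> i. A (f i) $ i))"
proof -
  have "(\<Sum>k\<in>S. c k *\<^sub>R A k) = (\<chi> i. \<Sum>k\<in>S. c k *s (A k $ i))"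
    by (simp add: vec_eq_iff sum_component)
  then have "det (\<Sum>k\<in>S. c k *\<^sub>R A k) = (\<Sum>f | \<forall>i. f i \<in> S. det (\<chi> i. c (f i) *s (A (f i) $ i)))"
    by (simp add: det_linear_rows_sum)
  also have "\<dots> = (\<Sum>f | range f \<subseteq> S. (\<Prod>i\<in>UNIV. c (f i)) * det (\<chi> i. A (f i) $ i))"
    by (rule sum.cong) (auto simp: det_rows_mul)
  finally show ?thesis .
qed

lemma sum_permutes_compose_functions:
  fixes F :: "('n::finite \<Rightarrow> 'n) \<Rightarrow> real"
  assumes "p permutes (UNIV :: 'n set)"
  shows "(\<Sum>f\<in>UNIV. F (f \<circ> p)) = (\<Sum>f\<in>UNIV. F f)"
proof (rule sum.reindex_bij_witness[of _ "\<lambda>f. f \<circ> inv p" "\<lambda>f. f \<circ> p"])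
qed (use permutes_inv_o[OF assms] in \<open>auto simp: o_assoc[symmetric]\<close>)

text \<open>
  Multilinearity in the rows expresses the left side through all row selections f. The right side
  symmetrises each term, which does not change the sum because f \<mapsto> f \<circ> p permutes the selections and
  preserves the product of coefficients.
\<close>
lemma det_sum_scaleR_mixed_disc:
  fixes A :: "'n::finite \<Rightarrow> real^'n^'n"
  shows "fact CARD('n) * det (\<Sum>k\<in>UNIV. c k *\<^sub>R A k) =
    (\<Sum>f\<in>UNIV. (\<Prod>i\<in>UNIV. c (f i)) * mixed_disc (A \<circ> f))"
proof -
  have "(\<Sum>f\<in>UNIV. (\<Prod>i\<in>UNIV. c (f i)) * mixed_disc (A \<circ> f)) =
     (\<Sum>p | p permutes (UNIV :: 'n set). \<Sum>f\<in>UNIV. (\<Prod>i\<in>UNIV. c (f i)) * det (\<chi> i. A (f (p i)) $ i))"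
    unfolding mixed_disc_def sum_distrib_left by (subst sum.swap) simp
  also have "\<dots> = (\<Sum>p | p permutes (UNIV :: 'n set). det (\<Sum>k\<in>UNIV. c k *\<^sub>R A k))"
  proof (rule sum.cong[OF refl])
    fix p assume "p \<in> {p. p permutes (UNIV :: 'n set)}"
    then have p: "p permutes (UNIV :: 'n set)" by simp
    have "(\<Sum>f\<in>UNIV. (\<Prod>i\<in>UNIV. c (f i)) * det (\<chi> i. A (f (p i)) $ i)) =
      (\<Sum>f\<in>UNIV. (\<Prod>i\<in>UNIV. c ((f \<circ> p) i)) * det (\<chi> i. A ((f \<circ> p) i) $ i))"
      using prod.permute[OF p, of "\<lambda>i. c (f i)" for f] by (simp add: comp_def)
    also have "\<dots> = det (\<Sum>k\<in>UNIV. c k *\<^sub>R A k)"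
      using sum_permutes_compose_functions[OF p, of "\<lambda>f. (\<Prod>i\<in>UNIV. c (f i)) * det (\<chi> i. A (f i) $ i)"]
      by (simp add: det_sum_scaleR)
    finally show "(\<Sum>f\<in>UNIV. (\<Prod>i\<in>UNIV. c (f i)) * det (\<chi> i. A (f (p i)) $ i)) = det (\<Sum>k\<in>UNIV. c k *\<^sub>R A k)" .
  qed
  also have "\<dots> = fact CARD('n) * det (\<Sum>k\<in>UNIV. c k *\<^sub>R A k)"
    by (simp add: card_permutations)
  finally show ?thesis by simp
qed

lemma mixed_disc_polarization:
  fixes A :: "'n::finite \<Rightarrow> real^'n^'n"
  shows "mixed_disc A = (\<Sum>S\<in>UNIV. (- 1) ^ (CARD('n) - card S) * det (\<Sum>k\<in>S. A k))"
proof -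
  have "(\<Sum>S\<in>UNIV. (- 1) ^ (CARD('n) - card S) * det (\<Sum>k\<in>S. A k)) =
     (\<Sum>S\<in>Pow (UNIV :: 'n set). (- 1) ^ (CARD('n) - card S) *
         (\<Sum>f | f \<in> UNIV \<and> range f \<subseteq> S. det (\<chi> i. A (f i) $ i)))"
    using det_sum_scaleR[of "\<lambda>_. 1" A] by simp
  also have "\<dots> = (\<Sum>f | f \<in> (UNIV :: ('n \<Rightarrow> 'n) set) \<and> range f = UNIV. det (\<chi> i. A (f i) $ i))"
    by (rule inclusion_exclusion_support) auto
  also have "\<dots> = mixed_disc A"
    unfolding mixed_disc_def
    by (rule sum.cong) (auto intro!: bij_imp_permutes dest: permutes_surj
        simp: bij_def finite_UNIV_surj_inj)
  finally show ?thesis by simp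
qed

lemma mixed_disc_permute:
  fixes A :: "'n::finite \<Rightarrow> real^'n^'n"
  assumes "p permutes UNIV"
  shows "mixed_disc (A \<circ> p) = mixed_disc A"
  unfolding mixed_disc_def
  using setum_permutations_compose_left[OF assms, of "\<lambda>q. det (\<chi> i. A (q i) $ i)"]
  by (simp add: comp_def)

lemma mixed_disc_const:
  fixes A :: "real^'n^'n"
  shows "mixed_disc (\<lambda>_. A) = fact CARD('n) * det A"
  by (simp add: mixed_disc_def card_permutations)

lemma mixed_disc_linear:
  fixes A :: "'n::finite \<Rightarrow> real^'n^'n"
  shows "mixed_disc (A(k := a *\<^sub>R B + b *\<^sub>R C)) =
     a * mixed_disc (A(k := B)) + b * mixed_disc (A(k := C))"
proof -
  have "det (\<chi> i. (A(k := a *\<^sub>R B + b *\<^sub>R C)) (p i) $ i) =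
      a * det (\<chi> i. (A(k := B)) (p i) $ i) + b * det (\<chi> i. (A(k := C)) (p i) $ i)"
    if p: "p permutes UNIV" for p
  proof -
    define l where "l = inv p k"
    have l: "p i = k \<longleftrightarrow> i = l" for i
      unfolding l_def using permutes_inv_eq[OF p, of k i] by metis
    have X: "(\<chi> i. (A(k := X)) (p i) $ i) = (\<chi> i. if i = l then X $ i else A (p i) $ i)" for X
      using l by (simp add: vec_eq_iff)
    have "(\<chi> i. if i = l then (a *\<^sub>R B + b *\<^sub>R C) $ i else A (p i) $ i) =
       (\<chi> i. if i = l then a *s (B $ i) + b *s (C $ i) else A (p i) $ i)"
      by (simp add: vec_eq_iff)
    then show ?thesis
      unfolding X by (simp only: det_row_add det_row_mul)
  qed
  then show ?thesis
    unfolding mixed_disc_def by (simp add: sum.distrib sum_distrib_left)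
qed

lemma mixed_disc_zero:
  fixes A :: "'n::finite \<Rightarrow> real^'n^'n"
  shows "mixed_disc (A(k := 0)) = 0"
proof -
  have "(0 :: real^'n^'n) = 0 *\<^sub>R 0 + 0 *\<^sub>R 0" by simp
  then show ?thesis using mixed_disc_linear[of A k 0 0 0 0] by (metis add_0_left mult_zero_left)
qed

lemma mixed_disc_sum:
  fixes A :: "'n::finite \<Rightarrow> real^'n^'n"
  assumes "finite J"
  shows "mixed_disc (A(k := (\<Sum>j\<in>J. B j))) = (\<Sum>j\<in>J. mixed_disc (A(k := B j)))"
  using assms
proof (induction J rule: finite_induct)
  case empty then show ?case by (simp only: sum.empty mixed_disc_zero)
next
  case (insert j J)
  then show ?case using mixed_disc_linear[of A k 1 "B j" 1 "\<Sum>j\<in>J. B j"]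
    unfolding sum.insert[OF insert.hyps] by (simp only: scaleR_one mult_1)
qed

section \<open>Positive semidefinite matrices\<close>

definition psd :: "real^'n^'n \<Rightarrow> bool" where
  "psd A \<longleftrightarrow> transpose A = A \<and> (\<forall>h. 0 \<le> h \<bullet> (A *v h))"

definition rank_one :: "real^'n \<Rightarrow> real^'n^'n" where
  "rank_one v = (\<chi> i. v $ i *s v)"

lemma rank_one_mult: "rank_one v *v h = (v \<bullet> h) *\<^sub>R v"
  by (simp add: rank_one_def vec_eq_iff matrix_vector_mult_def inner_vec_def sum_distrib_left mult_ac)

lemma transpose_rank_one: "transpose (rank_one v) = rank_one v"
  by (simp add: rank_one_def transpose_def vec_eq_iff mult.commute)

text \<open>
  Pulling the scalar factors out of the rows leaves a row permutation of the matrix of the v k. The sum of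
  the signed factors is the same determinant again, so that the result is a square. This is
  the source of all positivity below.
\<close>
lemma mixed_disc_rank_one:
  fixes v :: "'n::finite \<Rightarrow> real^'n"
  shows "mixed_disc (\<lambda>k. rank_one (v k)) = (det (\<chi> k. v k))\<^sup>2"
proof -
  have "det (\<chi> i. rank_one (v (p i)) $ i) = (\<Prod>i\<in>UNIV. v (p i) $ i) * (of_int (sign p) * det (\<chi> k. v k))"
    if p: "p permutes UNIV" for p
    using det_rows_mul[of "\<lambda>i. v (p i) $ i" "\<lambda>i. v (p i)"] det_permute_rows[OF p, of "\<chi> k. v k"]
    by (simp add: rank_one_def)
  then have "mixed_disc (\<lambda>k. rank_one (v k)) =
     (\<Sum>p | p permutes UNIV. of_int (sign p) * (\<Prod>i\<in>UNIV. transpose (\<chi> k. v k) $ i $ p i)) * det (\<chi> k. v k)"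
    unfolding mixed_disc_def sum_distrib_right by (intro sum.cong) (auto simp: transpose_def)
  also have "\<dots> = (det (\<chi> k. v k))\<^sup>2"
    using det_def[of "transpose (\<chi> k. v k)"] by (simp add: power2_eq_square det_transpose)
  finally show ?thesis .
qed

lemma psd_inner_commute: "psd A \<Longrightarrow> x \<bullet> (A *v y) = y \<bullet> (A *v x)"
  unfolding psd_def by (metis dot_lmul_matrix inner_commute transpose_matrix_vector)

text \<open>
  If A h were nonzero, moving from h a little in the direction - A h would make the quadratic form
  negative.
\<close>
lemma psd_zero_form:
  assumes "psd A" "h \<bullet> (A *v h) = 0"
  shows "A *v h = 0"
proof (rule ccontr)
  define w where "w = A *v h"
  assume "A *v h \<noteq> 0"
  then have w: "w \<bullet> w > 0" by (simp add: w_def)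
  define q where "q = w \<bullet> (A *v w)"
  have q: "0 \<le> q" using assms(1) by (simp add: q_def psd_def)
  have *: "0 \<le> t^2 * q + 2 * t * (w \<bullet> w)" for t
  proof -
    have "0 \<le> (h + t *\<^sub>R w) \<bullet> (A *v (h + t *\<^sub>R w))"
      using assms(1) by (simp add: psd_def)
    also have "\<dots> = t^2 * q + t * (w \<bullet> (A *v h)) + t * (h \<bullet> (A *v w))"
      using assms(2) by (simp add: algebra_simps inner_simps matrix_vector_mult_scaleR q_def power2_eq_square)
    also have "h \<bullet> (A *v w) = w \<bullet> (A *v h)" by (rule psd_inner_commute[OF assms(1)])
    finally show ?thesis by (simp add: w_def)
  qed
  define t where "t = - (w \<bullet> w) / (q + 1)"
  have "t^2 * q + 2 * t * (w \<bullet> w) < 0"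
  proof -
    have t: "t < 0" using w q by (simp add: t_def field_simps)
    have "t * q + 2 * (w \<bullet> w) > 0"
    proof -
      have "t * q = - (w \<bullet> w) * (q / (q + 1))" by (simp add: t_def)
      moreover have "q / (q + 1) \<le> 1" using q by simp
      ultimately have "t * q \<ge> - (w \<bullet> w)" using w mult_left_le[of "q / (q + 1)" "w \<bullet> w"] by simp
      then show ?thesis using w by linarith
    qed
    then have "t * (t * q + 2 * (w \<bullet> w)) < 0" using t by (simp add: mult_neg_pos)
    then show ?thesis by (simp add: algebra_simps power2_eq_square)
  qed
  then show False using *[of t] by linarith
qed

text \<open>
  Symmetric elimination: for a nonzero diagonal entry a at place i, subtracting the rank-one matrix of
  A e_i / sqrt a amounts to evaluating the form at h - t e_i with the optimal t, hence keeps it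
  positive semidefinite. It clears the entry at i and creates no new nonzero diagonal entry.
\<close>
lemma psd_sum_rank_one:
  fixes A :: "real^'n^'n"
  assumes "psd A"
  shows "\<exists>(J :: 'n set) v. A = (\<Sum>j\<in>J. rank_one (v j))"
proof -
  have "\<exists>v. A = (\<Sum>j | A $ j $ j \<noteq> 0. rank_one (v j))" if "psd A" for A :: "real^'n^'n"
    using that
  proof (induction "card {i. A $ i $ i \<noteq> 0}" arbitrary: A rule: less_induct)
    case less
    have quad: "axis i 1 \<bullet> (A *v axis i 1) = A $ i $ i" for A :: "real^'n^'n" and i
      by (simp add: matrix_vector_mult_basis inner_axis' column_def)
    have zero: "A *v axis i 1 = 0" if "A $ i $ i = 0" for i
      using psd_zero_form[OF less.prems] quad[of i A] that by simp
    show ?case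
    proof (cases "\<exists>i. A $ i $ i \<noteq> 0")
      case False
      then have "A *v axis j 1 = 0" for j using zero by blast
      then have "A = 0"
        by (metis (no_types) matrix_vector_mult_basis column_def vec_eq_iff vec_lambda_beta zero_index)
      then show ?thesis using False by simp
    next
      case True
      then obtain i where i: "A $ i $ i \<noteq> 0" by blast
      define u where "u = A *v axis i 1"
      define a where "a = A $ i $ i"
      have a: "a > 0" using i quad[of i A] less.prems by (metis a_def order_less_le psd_def)
      define w where "w = (1 / sqrt a) *\<^sub>R u"
      define B where "B = A - rank_one w"
      have Bv: "B *v h = A *v h - (u \<bullet> h / a) *\<^sub>R u" for h
        using a by (simp add: B_def matrix_vector_mult_diff_rdistrib rank_one_mult w_def field_simps)
      have uh: "u \<bullet> h = axis i 1 \<bullet> (A *v h)" for h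
        using psd_inner_commute[OF less.prems, of "axis i 1" h] by (simp add: u_def inner_commute)
      have ui: "u \<bullet> axis i 1 = a" by (simp add: uh quad a_def)
      have psdB: "psd B"
        unfolding psd_def
      proof (intro conjI allI)
        show "transpose B = B"
          using less.prems by (simp add: B_def psd_def transpose_rank_one) (simp add: transpose_def vec_eq_iff rank_one_def)
        fix h
        define t where "t = u \<bullet> h / a"
        have "h \<bullet> (B *v h) = (h - t *\<^sub>R axis i 1) \<bullet> (A *v (h - t *\<^sub>R axis i 1))"
        proof -
          have "(h - t *\<^sub>R axis i 1) \<bullet> (A *v (h - t *\<^sub>R axis i 1)) =
             h \<bullet> (A *v h) - t * (h \<bullet> u) - t * (axis i 1 \<bullet> (A *v h)) + t * t * a"
            by (simp add: algebra_simps inner_simps matrix_vector_mult_scaleR u_def quad a_def)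
          also have "\<dots> = h \<bullet> (A *v h) - t * (u \<bullet> h)"
            using a by (simp add: uh[symmetric] inner_commute t_def)
          also have "\<dots> = h \<bullet> (B *v h)"
            by (simp add: Bv inner_simps t_def inner_commute)
          finally show ?thesis by simp
        qed
        then show "0 \<le> h \<bullet> (B *v h)" using less.prems by (simp add: psd_def)
      qed
      have diag: "B $ j $ j = 0" if "A $ j $ j = 0" for j
      proof -
        have "u \<bullet> axis j 1 = 0" using zero[OF that] by (simp add: uh)
        then have "B *v axis j 1 = 0" using zero[OF that] by (simp add: Bv)
        then show ?thesis using quad[of j B] by simp
      qed
      have Bi: "B $ i $ i = 0"
        using quad[of i B] a by (simp add: Bv ui) (simp add: u_def)
      have sub: "{j. B $ j $ j \<noteq> 0} \<subseteq> {j. A $ j $ j \<noteq> 0} - {i}" using diag Bi by auto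
      then have "{j. B $ j $ j \<noteq> 0} \<subset> {j. A $ j $ j \<noteq> 0}" using i by blast
      then have "card {j. B $ j $ j \<noteq> 0} < card {j. A $ j $ j \<noteq> 0}" by (simp add: psubset_card_mono)
      then obtain v where v: "B = (\<Sum>j | B $ j $ j \<noteq> 0. rank_one (v j))"
        using less.hyps psdB by blast
      define v' where "v' j = (if j = i then w else if B $ j $ j \<noteq> 0 then v j else 0)" for j
      have "(\<Sum>j | A $ j $ j \<noteq> 0. rank_one (v' j)) =
          rank_one w + (\<Sum>j\<in>{j. A $ j $ j \<noteq> 0} - {i}. rank_one (v' j))"
        using i by (subst sum.remove[of _ i]) (auto simp: v'_def)
      also have "(\<Sum>j\<in>{j. A $ j $ j \<noteq> 0} - {i}. rank_one (v' j)) = (\<Sum>j | B $ j $ j \<noteq> 0. rank_one (v' j))"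
        by (rule sum.mono_neutral_right) (use sub in \<open>auto simp: v'_def rank_one_def vec_eq_iff\<close>)
      also have "\<dots> = B"
        by (subst (2) v) (rule sum.cong, use Bi in \<open>auto simp: v'_def\<close>)
      finally have "A = (\<Sum>j | A $ j $ j \<noteq> 0. rank_one (v' j))" by (simp add: B_def)
      then show ?thesis by (rule exI[of _ v'])
    qed
  qed
  from this[OF assms] show ?thesis by (rule exI)
qed

text \<open>
  By multilinearity the matrices can be replaced, one index after the other, by rank-one matrices, where
  mixed_disc_rank_one applies.
\<close>
lemma mixed_disc_nonneg:
  fixes A :: "'n::finite \<Rightarrow> real^'n^'n"
  assumes "\<And>k. psd (A k)"
  shows "0 \<le> mixed_disc A"
proof -
  have "0 \<le> mixed_disc A" if "\<And>k. k \<in> T \<Longrightarrow> psd (A k)" "\<And>k. k \<notin> T \<Longrightarrow> \<exists>v. A k = rank_one v"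
    for T :: "'n set" and A :: "'n \<Rightarrow> real^'n^'n"
    using finite[of T] that
  proof (induction T arbitrary: A rule: finite_induct)
    case empty
    then obtain v where "A k = rank_one (v k)" for k by (metis empty_iff)
    then have "A = (\<lambda>k. rank_one (v k))" by blast
    then show ?case by (simp add: mixed_disc_rank_one)
  next
    case (insert k T)
    obtain J v where Ak: "A k = (\<Sum>j\<in>(J :: 'n set). rank_one (v j))"
      using psd_sum_rank_one insert.prems(1) by blast
    have "mixed_disc (A(k := A k)) = (\<Sum>j\<in>J. mixed_disc (A(k := rank_one (v j))))"
      unfolding Ak by (rule mixed_disc_sum) simp
    moreover have "0 \<le> mixed_disc (A(k := rank_one (v j)))" for j
      by (rule insert.IH) (use insert.prems insert.hyps in auto)
    ultimately show ?case by (simp add: sum_nonneg)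
  qed
  then show ?thesis using assms by (metis UNIV_I)
qed

lemma psd_det_nonneg:
  fixes A :: "real^'n^'n"
  assumes "psd A"
  shows "0 \<le> det A"
proof -
  have "0 \<le> (fact CARD('n) :: real) * det A"
    using mixed_disc_nonneg[of "\<lambda>_. A"] assms by (simp add: mixed_disc_const)
  moreover have "(0 :: real) < fact CARD('n)" by simp
  ultimately show ?thesis using zero_le_mult_iff[of "fact CARD('n)" "det A"] by linarith
qed

lemma psd_0: "psd 0" by (simp add: psd_def transpose_def vec_eq_iff)

lemma psd_rank_one: "psd (rank_one v)"
  by (simp add: psd_def transpose_rank_one rank_one_mult inner_commute)

lemma psd_add: "psd A \<Longrightarrow> psd B \<Longrightarrow> psd (A + B)"
  by (simp add: psd_def transpose_def vec_eq_iff matrix_vector_mult_add_rdistrib inner_simps)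

lemma psd_scaleR: "psd A \<Longrightarrow> 0 \<le> c \<Longrightarrow> psd (c *\<^sub>R A)"
  by (simp add: psd_def transpose_def vec_eq_iff scaleR_matrix_vector_assoc[symmetric])

section \<open>Renaming coordinates\<close>

text \<open>
  A finite index type need not carry the wellorder for which the change of variables formula in \<real>^n
  is stated. It is therefore copied, the copy is ordered by an enumeration, and the formula is
  carried back along the renaming of coordinates, which preserves Lebesgue measure and determinants.
\<close>
typedef 'a ordered_copy = "UNIV :: 'a set" morphisms of_copy to_copy ..

definition copy_rank :: "'a::finite \<Rightarrow> nat" where
  "copy_rank = (SOME f. inj f)"

lemma inj_copy_rank: "inj (copy_rank :: 'a::finite \<Rightarrow> nat)"
proof -
  have "\<exists>f :: 'a \<Rightarrow> nat. inj f"
    using finite_imp_inj_to_nat_seg[of "UNIV :: 'a set"] by auto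
  then show ?thesis unfolding copy_rank_def by (rule someI_ex)
qed

lemma bij_of_copy: "bij of_copy"
  by (metis bijI' of_copy_inject to_copy_inverse UNIV_I)

instance ordered_copy :: (finite) finite
proof
  show "finite (UNIV :: 'a ordered_copy set)"
    using bij_of_copy finite[of "UNIV :: 'a set"] by (metis bij_betw_finite)
qed

instantiation ordered_copy :: (finite) wellorder
begin

definition less_eq_ordered_copy :: "'a ordered_copy \<Rightarrow> 'a ordered_copy \<Rightarrow> bool" where
  "x \<le> y \<longleftrightarrow> copy_rank (of_copy x) \<le> copy_rank (of_copy y)"

definition less_ordered_copy :: "'a ordered_copy \<Rightarrow> 'a ordered_copy \<Rightarrow> bool" where
  "x < y \<longleftrightarrow> copy_rank (of_copy x) < copy_rank (of_copy y)"

instance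
proof
  fix x y :: "'a ordered_copy"
  assume "x \<le> y" "y \<le> x"
  then have "copy_rank (of_copy x) = copy_rank (of_copy y)"
    unfolding less_eq_ordered_copy_def by simp
  then show "x = y"
    using inj_copy_rank by (metis injD of_copy_inject)
next
  fix P and a :: "'a ordered_copy"
  assume *: "\<And>x :: 'a ordered_copy. (\<And>y. y < x \<Longrightarrow> P y) \<Longrightarrow> P x"
  show "P a"
    by (induction "copy_rank (of_copy a)" arbitrary: a rule: less_induct)
      (metis * less_ordered_copy_def)
qed (auto simp: less_eq_ordered_copy_def less_ordered_copy_def)

end

lemma prod_Basis_vec:
  fixes x :: "real^'n"
  shows "(\<Prod>b\<in>Basis. x \<bullet> b) = (\<Prod>i\<in>UNIV. x $ i)"
proof -
  have "(Basis :: (real^'n) set) = (\<lambda>i. axis i 1) ` UNIV"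
    by (auto simp: Basis_vec_def)
  moreover have "inj (\<lambda>i :: 'n. axis i (1 :: real))"
    by (auto simp: inj_on_def axis_eq_axis)
  ultimately have "(\<Prod>b\<in>Basis. x \<bullet> b) = (\<Prod>i\<in>UNIV. x \<bullet> axis i 1)"
    using prod.reindex[of "\<lambda>i :: 'n. axis i (1 :: real)" UNIV "(\<bullet>) x"] by (simp add: comp_def)
  then show ?thesis by (simp add: inner_axis)
qed

lemma reindex_linear: "linear (\<lambda>x. \<chi> i. x $ f i :: real^'m)"
  by (auto intro!: linearI simp: vec_eq_iff)

lemma lborel_distr_reindex:
  fixes f :: "'m::finite \<Rightarrow> 'n::finite"
  assumes "bij f"
  shows "distr lborel borel (\<lambda>x :: real^'n. \<chi> i. x $ f i :: real^'m) = lborel"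
proof (rule lborel_eqI[symmetric])
  let ?T = "\<lambda>x :: real^'n. \<chi> i. x $ f i :: real^'m"
  have T[measurable]: "?T \<in> borel \<rightarrow>\<^sub>M borel"
    by (intro borel_measurable_continuous_onI linear_continuous_on linear_conv_bounded_linear[THEN iffD1] reindex_linear)
  fix l u :: "real^'m"
  assume lu: "\<And>b. b \<in> Basis \<Longrightarrow> l \<bullet> b \<le> u \<bullet> b"
  define g where "g = inv f"
  have fg: "f (g j) = j" "g (f i) = i" for i j
    using assms by (simp_all add: g_def bij_is_surj surj_f_inv_f bij_is_inj inv_f_f)
  have lu': "l $ i \<le> u $ i" for i
    using lu[of "axis i 1"] by (simp add: inner_axis)
  let ?l = "\<chi> j. l $ g j :: real^'n" and ?u = "\<chi> j. u $ g j :: real^'n"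
  have "?T -` box l u = box ?l ?u"
    by (auto simp: mem_box_cart) (metis fg)+
  then have "emeasure (distr lborel borel ?T) (box l u) = emeasure lborel (box ?l ?u)"
    by (simp add: emeasure_distr)
  also have "\<dots> = (\<Prod>b\<in>Basis. (?u - ?l) \<bullet> b)"
    by (rule emeasure_lborel_box) (use lu' in \<open>auto simp: Basis_vec_def inner_axis\<close>)
  also have "(\<Prod>b\<in>Basis. (?u - ?l) \<bullet> b) = (\<Prod>j\<in>UNIV. (u - l) $ g j)"
    unfolding prod_Basis_vec by simp
  also have "\<dots> = (\<Prod>i\<in>UNIV. (u - l) $ i)"
    by (rule prod.reindex_bij_witness[of _ f g]) (auto simp: fg)
  finally show "emeasure (distr lborel borel ?T) (box l u) = (\<Prod>b\<in>Basis. (u - l) \<bullet> b)"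
    unfolding prod_Basis_vec .
qed simp

lemma
  fixes f :: "'m::finite \<Rightarrow> 'n::finite"
  assumes "bij f"
  shows lebesgue_measurable_reindex: "(\<lambda>x :: real^'n. \<chi> i. x $ f i :: real^'m) \<in> lebesgue \<rightarrow>\<^sub>M lebesgue" (is "?T \<in> _")
    and lebesgue_distr_reindex: "distr lebesgue lebesgue (\<lambda>x :: real^'n. \<chi> i. x $ f i :: real^'m) = lebesgue"
proof -
  have T[measurable]: "?T \<in> borel \<rightarrow>\<^sub>M borel"
    by (intro borel_measurable_continuous_onI linear_continuous_on linear_conv_bounded_linear[THEN iffD1] reindex_linear)
  have d: "distr lebesgue lborel ?T = lborel"
    using lborel_distr_reindex[OF assms] by (subst distr_completion) (auto cong: distr_cong)
  show "?T \<in> lebesgue \<rightarrow>\<^sub>M lebesgue"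
    by (simp add: completion.measurable_completion2 d measurable_completion)
  have "lebesgue = completion (distr lebesgue lborel ?T)" by (simp add: d)
  also have "\<dots> = distr lebesgue lebesgue ?T"
    by (subst completion.completion_distr_eq) (auto simp: d measurable_completion)
  finally show "distr lebesgue lebesgue ?T = lebesgue" ..
qed

lemma measure_lebesgue_reindex:
  fixes f :: "'m::finite \<Rightarrow> 'n::finite" and S :: "(real^'n) set"
  assumes "bij f" "S \<in> lmeasurable"
  shows "(\<lambda>x. \<chi> i. x $ f i :: real^'m) ` S \<in> lmeasurable"
    "measure lebesgue ((\<lambda>x. \<chi> i. x $ f i :: real^'m) ` S) = measure lebesgue S"
proof -
  let ?T = "\<lambda>x :: real^'n. \<chi> i. x $ f i :: real^'m"
  let ?T' = "\<lambda>y :: real^'m. \<chi> j. y $ inv f j :: real^'n"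
  have inv: "?T' (?T x) = x" "?T (?T' y) = y" for x y
    using assms(1) by (simp_all add: vec_eq_iff bij_is_surj surj_f_inv_f bij_is_inj inv_f_f)
  have bij': "bij (inv f)" by (simp add: assms(1) bij_imp_bij_inv)
  have img: "?T ` S = ?T' -` S \<inter> space lebesgue"
  proof (intro set_eqI iffI)
    fix y assume "y \<in> ?T' -` S \<inter> space lebesgue"
    then have "?T' y \<in> S" by simp
    then show "y \<in> ?T ` S" by (rule image_eqI[rotated]) (rule inv(2)[symmetric])
  next
    fix y assume "y \<in> ?T ` S"
    then obtain x where "y = ?T x" "x \<in> S" by blast
    then show "y \<in> ?T' -` S \<inter> space lebesgue" using inv(1)[of x] by simp
  qed
  have S: "S \<in> sets lebesgue" using assms(2) by auto
  have "?T ` S \<in> sets lebesgue"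
    unfolding img by (rule measurable_sets[OF lebesgue_measurable_reindex[OF bij'] S])
  have em: "emeasure lebesgue (?T ` S) = emeasure lebesgue S"
    unfolding img
    using emeasure_distr[OF lebesgue_measurable_reindex[OF bij'] S] lebesgue_distr_reindex[OF bij'] by simp
  show "?T ` S \<in> lmeasurable"
    using \<open>?T ` S \<in> sets lebesgue\<close> assms(2) unfolding fmeasurable_def mem_Collect_eq em by blast
  show "measure lebesgue (?T ` S) = measure lebesgue S" using em by (simp add: measure_def)
qed

lemma has_integral_reindex:
  fixes f :: "'m::finite \<Rightarrow> 'n::finite" and F :: "real^'m \<Rightarrow> real"
  assumes "bij f" "\<And>y. 0 \<le> F y" "(F has_integral r) UNIV"
  shows "((\<lambda>x :: real^'n. F (\<chi> i. x $ f i)) has_integral r) UNIV"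
proof -
  have F: "F \<in> borel_measurable lebesgue" "integral\<^sup>N lebesgue F = r" "0 \<le> r"
    using assms(3) unfolding has_integral_iff_nn_integral_lebesgue[OF assms(2)] by auto
  have "(\<lambda>x :: real^'n. F (\<chi> i. x $ f i)) \<in> borel_measurable lebesgue"
    by (rule measurable_compose[OF lebesgue_measurable_reindex[OF assms(1)] F(1)])
  moreover have "(\<integral>\<^sup>+x. F (\<chi> i. x $ f i) \<partial>(lebesgue :: (real^'n) measure)) = r"
    using nn_integral_distr[OF lebesgue_measurable_reindex[OF assms(1)], of "\<lambda>y. ennreal (F y)"] F
    by (simp add: lebesgue_distr_reindex[OF assms(1)])
  ultimately show ?thesis
    using F(3) by (subst has_integral_iff_nn_integral_lebesgue) (auto simp: assms(2))
qed

lemma det_reindex: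
  fixes A :: "real^'n^'n" and f :: "'m::finite \<Rightarrow> 'n::finite"
  assumes f: "bij f"
  shows "det (\<chi> i j. A $ f i $ f j :: real^'m^'m) = det A"
proof -
  have "det (\<chi> i j. A $ f i $ f j) = (\<Sum>p | p permutes (UNIV :: 'm set). of_int (sign p) * (\<Prod>i\<in>UNIV. A $ f i $ f (p i)))"
    by (simp add: det_def)
  also have "\<dots> = (\<Sum>q | q permutes (UNIV :: 'n set). of_int (sign q) * (\<Prod>i\<in>UNIV. A $ i $ q i))"
  proof (rule sum.reindex_bij_witness[of _ "\<lambda>q i. inv f (q (f i))" "\<lambda>p j. f (p (inv f j))"])
    note fi = bij_is_surj[OF f, THEN surj_f_inv_f] bij_is_inj[OF f, THEN inv_f_f]
    fix p assume "p \<in> {p. p permutes (UNIV :: 'm set)}"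
    then interpret permutes_bij_finite p UNIV "UNIV :: 'n set" f "inv f" "\<lambda>j. f (p (inv f j))"
      by unfold_locales (use f fi in auto)
    show "(\<lambda>j. f (p (inv f j))) \<in> {q. q permutes UNIV}" using permutes_p' by simp
    show "(\<lambda>i. inv f (f (p (inv f (f i))))) = p" by (simp add: fi)
    have "(\<Prod>j\<in>UNIV. A $ j $ f (p (inv f j))) = (\<Prod>i\<in>UNIV. A $ f i $ f (p i))"
      by (rule prod.reindex_bij_witness[of _ f "inv f"]) (auto simp: fi)
    then show "of_int (sign (\<lambda>j. f (p (inv f j)))) * (\<Prod>j\<in>UNIV. A $ j $ f (p (inv f j))) =
       of_int (sign p) * (\<Prod>i\<in>UNIV. A $ f i $ f (p i))"
      using sign_p' by simp
  next
    note fi = bij_is_surj[OF f, THEN surj_f_inv_f] bij_is_inj[OF f, THEN inv_f_f]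
    fix q assume "q \<in> {q. q permutes (UNIV :: 'n set)}"
    then have "bij q" by (simp add: permutes_bij)
    then have "bij (inv f \<circ> (q \<circ> f))" using f by (intro bij_comp bij_imp_bij_inv)
    then show "(\<lambda>i. inv f (q (f i))) \<in> {p. p permutes UNIV}"
      using bij_imp_permutes[of "\<lambda>i. inv f (q (f i))" UNIV] by (simp add: comp_def)
    show "(\<lambda>j. f (inv f (q (f (inv f j))))) = q" by (simp add: fi)
  qed
  finally show ?thesis by (simp add: det_def)
qed

section \<open>The area formula\<close>

text \<open>
  Points where the Jacobian vanishes have an image of measure zero by Sard's theorem and contribute
  nothing to the integral, so that injectivity elsewhere suffices.
\<close>
lemma area_formula_wellorder:
  fixes g :: "real^'n::{finite,wellorder} \<Rightarrow> real^'n::_"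
  assumes der: "\<And>x. (g has_derivative (\<lambda>h. H x *v h)) (at x)"
    and inj: "inj_on g {x. det (H x) \<noteq> 0}"
    and meas: "range g \<in> lmeasurable"
  shows "((\<lambda>x. \<bar>det (H x)\<bar>) has_integral measure lebesgue (range g)) UNIV"
proof -
  define S where "S = {x. det (H x) \<noteq> 0}"
  have mat: "matrix (\<lambda>h. H x *v h) = H x" for x by simp
  have "(\<lambda>x. det (matrix (\<lambda>h. H x *v h))) \<in> borel_measurable (lebesgue_on UNIV)"
    by (rule borel_measurable_det_Jacobian[where f = g, OF _ has_derivative_at_withinI[OF der]]) simp
  then have m: "(\<lambda>x. det (H x)) \<in> borel_measurable lebesgue"
    unfolding mat by (simp add: lebesgue_on_UNIV_eq)
  have S: "S \<in> sets lebesgue"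
    using borel_measurable_neq[OF m, of "\<lambda>_. 0"] by (simp add: S_def)
  have neg: "negligible (g ` (- S))"
  proof (rule baby_Sard)
    show "rank (matrix (\<lambda>h. H x *v h)) < CARD('n)" if "x \<in> - S" for x
      using that unfolding mat by (simp add: S_def det_eq_0_rank)
  qed (simp_all add: has_derivative_at_withinI[OF der])
  have sub: "negligible (range g - g ` S)"
    by (rule negligible_subset[OF neg]) auto
  have eq: "range g - g ` S \<union> (g ` S - range g) = range g - g ` S" by auto
  have "g ` S \<in> lmeasurable \<and> measure lebesgue (g ` S) = measure lebesgue (range g)"
    using lmeasurable_negligible_symdiff[OF meas, of "g ` S"] measure_negligible_symdiff[of "range g" "g ` S"]
      meas sub unfolding eq by (simp add: fmeasurableD)
  then have "((\<lambda>x. \<bar>det (matrix (\<lambda>h. H x *v h))\<bar>) has_integral measure lebesgue (range g)) S"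
    using has_measure_differentiable_image[OF S has_derivative_at_withinI[OF der] inj[folded S_def]]
    by blast
  then have "((\<lambda>x. if x \<in> S then \<bar>det (H x)\<bar> else 0) has_integral measure lebesgue (range g)) UNIV"
    unfolding mat by (simp add: has_integral_restrict_UNIV)
  then show ?thesis
    by (rule has_integral_eq[rotated]) (auto simp: S_def)
qed

lemma area_formula:
  fixes g :: "real^'n \<Rightarrow> real^'n"
  assumes der: "\<And>x. (g has_derivative (\<lambda>h. H x *v h)) (at x)"
    and inj: "inj_on g {x. det (H x) \<noteq> 0}"
    and meas: "range g \<in> lmeasurable"
  shows "((\<lambda>x. \<bar>det (H x)\<bar>) has_integral measure lebesgue (range g)) UNIV"
proof -
  define f :: "'n ordered_copy \<Rightarrow> 'n" where "f = of_copy"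
  have f: "bij f" by (simp add: f_def bij_of_copy)
  note fi = bij_is_surj[OF f, THEN surj_f_inv_f] bij_is_inj[OF f, THEN inv_f_f]
  define T where "T = (\<lambda>x :: real^'n. \<chi> i. x $ f i :: real^'n ordered_copy)"
  define T' where "T' = (\<lambda>y :: real^'n ordered_copy. \<chi> j. y $ inv f j :: real^'n)"
  have inv: "T' (T x) = x" "T (T' y) = y" for x y
    by (simp_all add: T_def T'_def fi)
  define R where "R = (\<lambda>A :: real^'n^'n. \<chi> i j. A $ f i $ f j :: real^'n ordered_copy^'n ordered_copy)"
  have detR: "det (R A) = det A" for A
    unfolding R_def by (rule det_reindex[OF f])
  have Rmult: "R A *v h = T (A *v T' h)" for A h
  proof -
    have "(\<Sum>j\<in>UNIV. A $ f i $ f j * h $ j) = (\<Sum>k\<in>UNIV. A $ f i $ k * h $ inv f k)" for i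
      by (rule sum.reindex_bij_witness[of _ "inv f" f]) (auto simp: fi)
    then show ?thesis by (simp add: R_def T_def T'_def matrix_vector_mult_def vec_eq_iff)
  qed
  have bl: "bounded_linear T" "bounded_linear T'"
    unfolding T_def T'_def by (simp_all only: linear_conv_bounded_linear[symmetric] reindex_linear)
  have ran: "range (\<lambda>y. T (g (T' y))) = T ` range g"
  proof (intro set_eqI iffI)
    fix z assume "z \<in> T ` range g"
    then obtain x where "z = T (g x)" by blast
    then have "z = T (g (T' (T x)))" by (simp add: inv)
    then show "z \<in> range (\<lambda>y. T (g (T' y)))" by (rule image_eqI) simp
  qed blast
  have "((\<lambda>y. \<bar>det (R (H (T' y)))\<bar>) has_integral measure lebesgue (range (\<lambda>y. T (g (T' y))))) UNIV"
  proof (rule area_formula_wellorder)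
    fix y
    have "((\<lambda>y. T (g (T' y))) has_derivative (\<lambda>h. T (H (T' y) *v T' h))) (at y)"
      by (rule bounded_linear.has_derivative[OF bl(1)],
          rule has_derivative_compose[OF bounded_linear_imp_has_derivative[OF bl(2)] der])
    then show "((\<lambda>y. T (g (T' y))) has_derivative (\<lambda>h. R (H (T' y)) *v h)) (at y)"
      by (simp add: Rmult)
  next
    show "inj_on (\<lambda>y. T (g (T' y))) {y. det (R (H (T' y))) \<noteq> 0}"
    proof (rule inj_onI)
      fix y z assume yz: "y \<in> {y. det (R (H (T' y))) \<noteq> 0}" "z \<in> {y. det (R (H (T' y))) \<noteq> 0}"
        "T (g (T' y)) = T (g (T' z))"
      then have "g (T' y) = g (T' z)" by (metis inv(1))
      then have "T' y = T' z" using yz inj by (auto simp: detR inj_on_def)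
      then show "y = z" by (metis inv(2))
    qed
  next
    show "range (\<lambda>y. T (g (T' y))) \<in> lmeasurable"
      unfolding ran unfolding T_def using measure_lebesgue_reindex(1)[OF f meas] by simp
  qed
  moreover have "measure lebesgue (T ` range g) = measure lebesgue (range g)"
    unfolding T_def by (rule measure_lebesgue_reindex(2)[OF f meas])
  ultimately have "((\<lambda>y. \<bar>det (H (T' y))\<bar>) has_integral measure lebesgue (range g)) UNIV"
    by (simp add: detR ran)
  then have "((\<lambda>x. \<bar>det (H (T' (\<chi> i. x $ f i)))\<bar>) has_integral measure lebesgue (range g)) UNIV"
    by (rule has_integral_reindex[OF f, rotated]) simp
  then show ?thesis using inv(1) by (simp add: T_def)
qed

section \<open>Potentials of compact convex sets\<close>

text \<open>
  A convex function \<phi> with gradient g and Hessian H that behaves at infinity like the support function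
  of K: since the gradients lie in K, \<phi> exceeds it by at most a constant, and the last condition bounds
  \<phi> from below. The error \<epsilon> |x| is allowed because the potentials constructed below reach the support
  function only up to a sublinear term.
\<close>
definition potential ::
  "(real^'n) set \<Rightarrow> (real^'n \<Rightarrow> real) \<Rightarrow> (real^'n \<Rightarrow> real^'n) \<Rightarrow> (real^'n \<Rightarrow> real^'n^'n) \<Rightarrow> bool" where
  "potential K \<phi> g H \<longleftrightarrow>
     (\<forall>x. (\<phi> has_derivative (\<lambda>h. g x \<bullet> h)) (at x)) \<and>
     (\<forall>x. (g has_derivative (\<lambda>h. H x *v h)) (at x)) \<and>
     (\<forall>x. psd (H x)) \<and> (\<forall>x. g x \<in> K) \<and>
     (\<forall>\<epsilon>>0. \<exists>C. \<forall>x. \<forall>p\<in>K. p \<bullet> x - \<epsilon> * norm x - C \<le> \<phi> x)"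

lemma potential_lower:
  assumes "potential K \<phi> g H" "\<epsilon> > 0"
  obtains C where "\<And>x p. p \<in> K \<Longrightarrow> p \<bullet> x - \<epsilon> * norm x - C \<le> \<phi> x"
  using assms unfolding potential_def by blast

text \<open>
  If g takes the same value at both ends of a segment, then its component along the segment, which
  is nondecreasing, is constant there; so the Hessian annihilates the direction of the
  segment.
\<close>
lemma monotone_gradient_inj:
  fixes g :: "real^'n \<Rightarrow> real^'n"
  assumes der: "\<And>x. (g has_derivative (\<lambda>h. H x *v h)) (at x)"
    and psd: "\<And>x. psd (H x)"
  shows "inj_on g {x. det (H x) \<noteq> 0}"
proof (rule inj_onI, rule ccontr)
  fix x y assume xy: "x \<in> {x. det (H x) \<noteq> 0}" "g x = g y" "x \<noteq> y"
  define d where "d = y - x"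
  define \<psi> where "\<psi> t = d \<bullet> g (x + t *\<^sub>R d)" for t :: real
  have D: "(\<psi> has_real_derivative d \<bullet> (H (x + t *\<^sub>R d) *v d)) (at t)" for t
  proof -
    have "((\<lambda>t. x + t *\<^sub>R d) has_derivative (\<lambda>s. s *\<^sub>R d)) (at t)"
      by (auto intro!: derivative_eq_intros)
    from has_derivative_compose[OF this der]
    have "((\<lambda>t. d \<bullet> g (x + t *\<^sub>R d)) has_derivative (\<lambda>s. d \<bullet> (H (x + t *\<^sub>R d) *v (s *\<^sub>R d)))) (at t)"
      by (rule has_derivative_inner_right)
    then show ?thesis
      unfolding has_field_derivative_def \<psi>_def
      by (rule has_derivative_eq_rhs) (auto simp: matrix_vector_mult_scaleR mult.commute)
  qed
  have "H x *v d \<noteq> 0"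
  proof
    assume "H x *v d = 0"
    moreover have "d \<noteq> 0" using xy by (simp add: d_def)
    ultimately show False
      using xy(1) by (auto simp: invertible_det_nz[symmetric] invertible_left_inverse matrix_left_invertible_ker)
  qed
  then have "d \<bullet> (H x *v d) \<noteq> 0" using psd_zero_form[OF psd] by blast
  then have "d \<bullet> (H x *v d) > 0" using psd[of x] by (simp add: psd_def order_less_le)
  then obtain e where e: "e > 0" "\<And>h. 0 < h \<Longrightarrow> h < e \<Longrightarrow> \<psi> 0 < \<psi> h"
    using DERIV_pos_inc_right[OF D[of 0]] by auto
  define h where "h = min (e / 2) 1"
  have h: "0 < h" "h < e" "h \<le> 1" using e by (auto simp: h_def)
  have "\<psi> h \<le> \<psi> 1"
  proof (rule DERIV_nonneg_imp_nondecreasing[OF h(3)])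
    fix t show "\<exists>y. (\<psi> has_real_derivative y) (at t) \<and> 0 \<le> y"
      using D[of t] psd[of "x + t *\<^sub>R d"] by (auto simp: psd_def)
  qed
  moreover have "\<psi> 1 = \<psi> 0" using xy by (simp add: \<psi>_def d_def)
  ultimately show False using e(2)[OF h(1,2)] by simp
qed

text \<open>
  For p in the interior of K the function \<phi>(x) - p \<bullet> x tends to infinity with |x|, because the ball
  of radius r around p lies in K and r beats the error \<epsilon> = r / 2. It attains its minimum at a point with
  gradient p.
\<close>
lemma interior_subset_gradient_range:
  fixes K :: "(real^'n) set"
  assumes "potential K \<phi> g H"
  shows "interior K \<subseteq> range g"
proof
  fix p assume "p \<in> interior K"
  then obtain r where r: "r > 0" "cball p r \<subseteq> K" using mem_interior_cball by blast
  have "r / 2 > 0" using r by simp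
  then obtain C where C: "\<And>x q. q \<in> K \<Longrightarrow> q \<bullet> x - r / 2 * norm x - C \<le> \<phi> x"
    using assms unfolding potential_def by blast
  define F where "F x = \<phi> x - p \<bullet> x" for x
  have D: "(F has_derivative (\<lambda>h. (g x - p) \<bullet> h)) (at x)" for x
    using assms unfolding F_def potential_def
    by (auto intro!: derivative_eq_intros simp: inner_diff_left)
  have low: "r / 2 * norm x - C \<le> F x" for x
  proof -
    \<comment> \<open>at x = 0 the quotient is 0 and q is p itself, which is still in K\<close>
    define q where "q = p + (r / norm x) *\<^sub>R x"
    have "norm ((r / norm x) *\<^sub>R x) \<le> r" using r by simp
    then have "q \<in> K" using r by (intro subsetD[OF r(2)]) (simp add: q_def dist_norm)
    moreover have "q \<bullet> x = p \<bullet> x + r * norm x"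
      by (simp add: q_def inner_add_left power2_norm_eq_inner[symmetric] power2_eq_square)
    ultimately show ?thesis using C[of q x] by (simp add: F_def)
  qed
  define M where "M = max 0 ((F 0 + C) * 2 / r)"
  have "continuous_on (cball 0 M) F"
    using D by (meson continuous_at_imp_continuous_on has_derivative_continuous)
  moreover have "cball 0 M \<noteq> ({} :: (real^'n) set)" by (simp add: M_def)
  ultimately obtain x where x: "x \<in> cball 0 M" "\<And>y. y \<in> cball 0 M \<Longrightarrow> F x \<le> F y"
    using continuous_attains_inf[of "cball 0 M" F] by auto
  have "F x \<le> F y" for y
  proof (cases "y \<in> cball 0 M")
    case False
    then have "norm y \<ge> (F 0 + C) * 2 / r" by (simp add: M_def)
    then have "r / 2 * norm y \<ge> F 0 + C" using r by (simp add: field_simps)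
    then have "F 0 \<le> F y" using low[of y] by simp
    moreover have "F x \<le> F 0" by (rule x) (simp add: M_def)
    ultimately show ?thesis by simp
  qed (use x in simp)
  then have "(\<lambda>h. (g x - p) \<bullet> h) = (\<lambda>h. 0)"
    using differential_zero_maxmin[OF UNIV_I open_UNIV D] by blast
  then have "(g x - p) \<bullet> (g x - p) = 0" by metis
  then show "p \<in> range g" by auto
qed

text \<open>
  Also covers sets with empty interior, where both sides are 0: the gradient then ranges over a null
  set, and the Hessian is singular almost everywhere.
\<close>
lemma potential_det_integral:
  fixes K :: "(real^'n) set"
  assumes "convex K" "compact K" and pot: "potential K \<phi> g H"
  shows "((\<lambda>x. det (H x)) has_integral measure lebesgue K) UNIV"
proof -
  have K: "K \<in> lmeasurable" by (simp add: assms(2) lmeasurable_compact)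
  have sub: "interior K \<subseteq> range g" "range g \<subseteq> K"
    using interior_subset_gradient_range[OF pot] pot by (auto simp: potential_def)
  have "negligible (K - range g \<union> (range g - K))"
    by (rule negligible_subset[OF negligible_convex_frontier[OF assms(1)]])
      (use sub closure_subset in \<open>auto simp: frontier_def\<close>)
  then have m: "range g \<in> lmeasurable" "measure lebesgue (range g) = measure lebesgue K"
    using lmeasurable_negligible_symdiff[OF K] measure_negligible_symdiff[of K "range g"] K
    by (auto simp: fmeasurableD)
  have der: "\<And>x. (g has_derivative (\<lambda>h. H x *v h)) (at x)" and psd: "\<And>x. psd (H x)"
    using pot by (auto simp: potential_def)
  have "((\<lambda>x. \<bar>det (H x)\<bar>) has_integral measure lebesgue K) UNIV"
    using area_formula[OF der monotone_gradient_inj[OF der psd] m(1)] m(2) by simp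
  then show ?thesis using psd_det_nonneg[OF psd] by simp
qed

lemma potential_singleton: "potential {p} (\<lambda>x. p \<bullet> x) (\<lambda>x. p) (\<lambda>x. 0)"
proof -
  have "\<exists>C. \<forall>x. p \<bullet> x - \<epsilon> * norm x - C \<le> p \<bullet> x" if "\<epsilon> > 0" for \<epsilon> :: real
    by (rule exI[of _ 0]) (use that in auto)
  then show ?thesis
    by (auto simp: potential_def psd_0 intro!: derivative_eq_intros)
qed

lemma potential_scaleR:
  assumes "potential K \<phi> g H" "0 \<le> c"
  shows "potential ((*\<^sub>R) c ` K) (\<lambda>x. c * \<phi> x) (\<lambda>x. c *\<^sub>R g x) (\<lambda>x. c *\<^sub>R H x)"
proof -
  have "\<exists>C. \<forall>x. \<forall>p\<in>(*\<^sub>R) c ` K. p \<bullet> x - \<epsilon> * norm x - C \<le> c * \<phi> x" if "\<epsilon> > 0" for \<epsilon>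
  proof -
    \<comment> \<open>dividing by c + 1 instead of c includes the case c = 0\<close>
    have "\<epsilon> / (c + 1) > 0" using that assms(2) by simp
    from potential_lower[OF assms(1) this]
    obtain C where C: "\<And>x p. p \<in> K \<Longrightarrow> p \<bullet> x - \<epsilon> / (c + 1) * norm x - C \<le> \<phi> x" by blast
    have "(c *\<^sub>R p) \<bullet> x - \<epsilon> * norm x - c * C \<le> c * \<phi> x" if "p \<in> K" for p x
    proof -
      have "c * (p \<bullet> x - \<epsilon> / (c + 1) * norm x - C) \<le> c * \<phi> x"
        using C[OF that] assms(2) by (rule mult_left_mono)
      moreover have "c / (c + 1) * (\<epsilon> * norm x) \<le> 1 * (\<epsilon> * norm x)"
        by (rule mult_right_mono) (use assms(2) \<open>\<epsilon> > 0\<close> in auto)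
      ultimately show ?thesis by (simp add: algebra_simps)
    qed
    then show ?thesis by blast
  qed
  then show ?thesis
    using assms unfolding potential_def
    by (auto intro!: derivative_eq_intros psd_scaleR simp: scaleR_matrix_vector_assoc)
qed

lemma potential_add:
  assumes "potential K \<phi> g H" "potential K' \<phi>' g' H'"
  shows "potential (K + K') (\<lambda>x. \<phi> x + \<phi>' x) (\<lambda>x. g x + g' x) (\<lambda>x. H x + H' x)"
proof -
  have "\<exists>C. \<forall>x. \<forall>p\<in>K + K'. p \<bullet> x - \<epsilon> * norm x - C \<le> \<phi> x + \<phi>' x" if "\<epsilon> > 0" for \<epsilon>
  proof -
    have "\<epsilon> / 2 > 0" using that by simp
    from potential_lower[OF assms(1) this]
    obtain C where C: "\<And>x p. p \<in> K \<Longrightarrow> p \<bullet> x - \<epsilon> / 2 * norm x - C \<le> \<phi> x" by blast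
    from potential_lower[OF assms(2) \<open>\<epsilon> / 2 > 0\<close>]
    obtain C' where C': "\<And>x p. p \<in> K' \<Longrightarrow> p \<bullet> x - \<epsilon> / 2 * norm x - C' \<le> \<phi>' x" by blast
    have "(p + p') \<bullet> x - \<epsilon> * norm x - (C + C') \<le> \<phi> x + \<phi>' x" if "p \<in> K" "p' \<in> K'" for p p' x
      using C[OF that(1), of x] C'[OF that(2), of x] by (simp add: inner_add_left)
    then have "\<forall>x. \<forall>q\<in>K + K'. q \<bullet> x - \<epsilon> * norm x - (C + C') \<le> \<phi> x + \<phi>' x"
      by (auto elim!: set_plus_elim)
    then show ?thesis by blast
  qed
  then show ?thesis
    using assms unfolding potential_def
    by (auto intro!: derivative_eq_intros psd_add simp: matrix_vector_mult_add_rdistrib inner_add_left)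
qed

lemma potential_sum:
  fixes K :: "'i \<Rightarrow> (real^'n) set"
  assumes "finite J" "\<And>k. k \<in> J \<Longrightarrow> potential (K k) (\<phi> k) (g k) (H k)"
  shows "potential (\<Sum>k\<in>J. K k) (\<lambda>x. \<Sum>k\<in>J. \<phi> k x) (\<lambda>x. \<Sum>k\<in>J. g k x) (\<lambda>x. \<Sum>k\<in>J. H k x)"
  using assms
proof (induction J rule: finite_induct)
  case empty
  then show ?case using potential_singleton[of 0] by (simp add: set_zero)
next
  case (insert k J)
  then show ?case by (simp add: potential_add)
qed

text \<open>
  The function is ln (exp u + \<epsilon> exp v). As \<epsilon> tends to 0, the weight \<theta> tends to 1 at every
  point, and the Hessian tends to that of u, although the behaviour at infinity is that of the larger set M for
  each \<epsilon> > 0.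
\<close>
lemma potential_ln_add_exp:
  fixes M :: "(real^'n) set"
  assumes L: "potential L u gu Hu" and M: "potential M v gv Hv"
    and sub: "L \<subseteq> M" "convex M" and \<epsilon>: "\<epsilon> > 0"
  defines "\<theta> \<equiv> \<lambda>x. 1 / (1 + \<epsilon> * exp (v x - u x))"
  shows "potential M (\<lambda>x. u x + ln (1 + \<epsilon> * exp (v x - u x)))
     (\<lambda>x. \<theta> x *\<^sub>R gu x + (1 - \<theta> x) *\<^sub>R gv x)
     (\<lambda>x. \<theta> x *\<^sub>R Hu x + (1 - \<theta> x) *\<^sub>R Hv x + (\<theta> x * (1 - \<theta> x)) *\<^sub>R rank_one (gv x - gu x))"
proof -
  define s where "s x = \<epsilon> * exp (v x - u x)" for x
  have s: "s x > 0" for x using \<epsilon> by (simp add: s_def)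
  have \<theta>s: "\<theta> x = 1 / (1 + s x)" for x by (simp add: \<theta>_def s_def)
  have \<theta>: "0 \<le> \<theta> x" "\<theta> x \<le> 1" for x using s[of x] by (auto simp: \<theta>s)
  have du: "(u has_derivative (\<lambda>h. gu x \<bullet> h)) (at x)" and dgu: "(gu has_derivative (\<lambda>h. Hu x *v h)) (at x)"
    and dv: "(v has_derivative (\<lambda>h. gv x \<bullet> h)) (at x)" and dgv: "(gv has_derivative (\<lambda>h. Hv x *v h)) (at x)" for x
    using L M by (auto simp: potential_def)
  have ds: "(s has_derivative (\<lambda>h. s x * ((gv x - gu x) \<bullet> h))) (at x)" for x
    unfolding s_def by (auto intro!: derivative_eq_intros du dv simp: inner_diff_left algebra_simps)
  have d\<theta>: "(\<theta> has_derivative (\<lambda>h. - (\<theta> x * (1 - \<theta> x)) * ((gv x - gu x) \<bullet> h))) (at x)" for x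
  proof -
    have "((\<lambda>x. 1 / (1 + s x)) has_derivative (\<lambda>h. - (s x * ((gv x - gu x) \<bullet> h)) / (1 + s x)^2)) (at x)"
      using s[of x] by (auto intro!: derivative_eq_intros ds simp: power2_eq_square)
    moreover have "- (s x * a) / (1 + s x)^2 = - (\<theta> x * (1 - \<theta> x)) * a" for a
    proof -
      have "1 - \<theta> x = s x / (1 + s x)" using s[of x] by (simp add: \<theta>s field_simps)
      then show ?thesis by (simp add: \<theta>s power2_eq_square)
    qed
    ultimately show ?thesis by (simp add: \<theta>s[abs_def])
  qed
  have 1: "((\<lambda>x. u x + ln (1 + s x)) has_derivative (\<lambda>h. (\<theta> x *\<^sub>R gu x + (1 - \<theta> x) *\<^sub>R gv x) \<bullet> h)) (at x)" for x
  proof -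
    have "((\<lambda>x. u x + ln (1 + s x)) has_derivative (\<lambda>h. gu x \<bullet> h + s x * ((gv x - gu x) \<bullet> h) / (1 + s x))) (at x)"
      using s[of x] by (auto intro!: derivative_eq_intros du ds simp: field_simps)
    moreover have "gu x \<bullet> h + s x * ((gv x - gu x) \<bullet> h) / (1 + s x) = (\<theta> x *\<^sub>R gu x + (1 - \<theta> x) *\<^sub>R gv x) \<bullet> h" for h
    proof -
      have "s x / (1 + s x) = 1 - \<theta> x" using s[of x] by (simp add: \<theta>s field_simps)
      then have "s x * ((gv x - gu x) \<bullet> h) / (1 + s x) = (1 - \<theta> x) * ((gv x - gu x) \<bullet> h)"
        by (metis times_divide_eq_left)
      then show ?thesis by (simp add: inner_simps algebra_simps)
    qed
    ultimately show ?thesis by simp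
  qed
  have 2: "((\<lambda>x. \<theta> x *\<^sub>R gu x + (1 - \<theta> x) *\<^sub>R gv x) has_derivative
     (\<lambda>h. (\<theta> x *\<^sub>R Hu x + (1 - \<theta> x) *\<^sub>R Hv x + (\<theta> x * (1 - \<theta> x)) *\<^sub>R rank_one (gv x - gu x)) *v h)) (at x)" for x
    by (rule derivative_eq_intros refl d\<theta> dgu dgv)+
      (simp add: matrix_vector_mult_add_rdistrib scaleR_matrix_vector_assoc[symmetric] rank_one_mult algebra_simps)
  have 3: "psd (\<theta> x *\<^sub>R Hu x + (1 - \<theta> x) *\<^sub>R Hv x + (\<theta> x * (1 - \<theta> x)) *\<^sub>R rank_one (gv x - gu x))" for x
    using L M \<theta>[of x] by (intro psd_add psd_scaleR psd_rank_one) (auto simp: potential_def)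
  have 4: "\<theta> x *\<^sub>R gu x + (1 - \<theta> x) *\<^sub>R gv x \<in> M" for x
    using L M \<theta>[of x] sub by (intro convexD) (auto simp: potential_def)
  have 5: "\<exists>C. \<forall>x. \<forall>p\<in>M. p \<bullet> x - e * norm x - C \<le> u x + ln (1 + s x)" if "e > 0" for e
  proof -
    obtain C where C: "\<And>x p. p \<in> M \<Longrightarrow> p \<bullet> x - e * norm x - C \<le> v x"
      using potential_lower[OF M \<open>e > 0\<close>] by blast
    have above: "v x + ln \<epsilon> \<le> u x + ln (1 + s x)" for x
    proof -
      have "ln (s x) \<le> ln (1 + s x)" using s[of x] by simp
      moreover have "ln (s x) = ln \<epsilon> + (v x - u x)" using \<epsilon> by (simp add: s_def ln_mult)
      ultimately show ?thesis by simp
    qed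
    have "p \<bullet> x - e * norm x - (C - ln \<epsilon>) \<le> u x + ln (1 + s x)" if "p \<in> M" for p x
      using C[OF that, of x] above[of x] by linarith
    then show ?thesis by blast
  qed
  show ?thesis
    using 1 2 3 4 5 unfolding potential_def s_def by blast
qed

section \<open>Existence of potentials\<close>

text \<open>
  Covers, with c = 1 and c = q, the first two derivatives of the Laplace transform from which potentials
  are made.
\<close>
lemma exp_inner_integral_derivative:
  fixes q :: "'b::euclidean_space \<Rightarrow> 'a::euclidean_space" and c :: "'b \<Rightarrow> 'c::euclidean_space"
  assumes q: "continuous_on (cbox a b) q" and c: "continuous_on (cbox a b) c"
  shows "((\<lambda>x. integral (cbox a b) (\<lambda>z. exp (x \<bullet> q z) *\<^sub>R c z)) has_derivative
     (\<lambda>h. integral (cbox a b) (\<lambda>z. (exp (x \<bullet> q z) * (h \<bullet> q z)) *\<^sub>R c z))) (at x)"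
proof -
  define fx where "fx x z = exp (x \<bullet> q z) *\<^sub>R (blinfun_scaleR_left (c z) o\<^sub>L blinfun_inner_left (q z))" for x z
  have app: "blinfun_apply (fx x z) h = (exp (x \<bullet> q z) * (h \<bullet> q z)) *\<^sub>R c z" for x z h
    by (simp add: fx_def scaleR_blinfun.rep_eq inner_commute)
  have qs: "continuous_on (UNIV \<times> cbox a b) (\<lambda>p. q (snd p))"
    by (rule continuous_on_compose2[OF q]) (auto intro: continuous_intros)
  have cs: "continuous_on (UNIV \<times> cbox a b) (\<lambda>p. c (snd p))"
    by (rule continuous_on_compose2[OF c]) (auto intro: continuous_intros)
  have cont: "continuous_on (UNIV \<times> cbox a b) (\<lambda>(x, z). fx x z)"
    unfolding fx_def split_beta
    by (intro continuous_intros qs cs bounded_linear.continuous_on[OF bounded_linear_blinfun_scaleR_left]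
        bounded_linear.continuous_on[OF bounded_linear_blinfun_inner_left])
  have contx: "continuous_on (cbox a b) (fx x)" for x
    using continuous_on_compose2[OF cont, of "cbox a b" "\<lambda>z. (x, z)"]
    by (simp add: image_subset_iff continuous_on_Pair)
  have "((\<lambda>x. integral (cbox a b) (\<lambda>z. exp (x \<bullet> q z) *\<^sub>R c z)) has_derivative
      blinfun_apply (integral (cbox a b) (fx x))) (at x within UNIV)"
  proof (rule leibniz_rule[OF _ _ cont])
    fix x z
    have "((\<lambda>x. exp (x \<bullet> q z) *\<^sub>R c z) has_derivative (\<lambda>h. (exp (x \<bullet> q z) * (h \<bullet> q z)) *\<^sub>R c z)) (at x within UNIV)"
      by (auto intro!: derivative_eq_intros simp: mult.commute)
    then show "((\<lambda>x. exp (x \<bullet> q z) *\<^sub>R c z) has_derivative blinfun_apply (fx x z)) (at x within UNIV)"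
      by (simp add: app[abs_def])
    show "(\<lambda>z. exp (x \<bullet> q z) *\<^sub>R c z) integrable_on cbox a b"
      by (intro integrable_continuous continuous_intros q c)
  qed auto
  moreover have "blinfun_apply (integral (cbox a b) (fx x)) =
      (\<lambda>h. integral (cbox a b) (\<lambda>z. (exp (x \<bullet> q z) * (h \<bullet> q z)) *\<^sub>R c z))"
    by (rule ext) (simp add: blinfun_apply_integral integrable_continuous[OF contx] app)
  ultimately show ?thesis by simp
qed

lemma psd_matrixI:
  fixes f :: "real^'n \<Rightarrow> real^'n"
  assumes "linear f" "\<And>h k. h \<bullet> f k = k \<bullet> f h" "\<And>h. 0 \<le> h \<bullet> f h"
  shows "psd (matrix f)"
proof -
  have "f (axis i 1) $ j = f (axis j 1) $ i" for i j
    using assms(2)[of "axis j 1" "axis i 1"] by (simp add: inner_axis')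
  then have "transpose (matrix f) = matrix f"
    by (simp add: matrix_def transpose_def vec_eq_iff)
  then show ?thesis using assms(1,3) by (simp add: psd_def matrix_works)
qed

text \<open>
  Let q be the nearest-point map to K and average over z in a box. Then the potential is ln E exp (x \<bullet> q z),
  the cumulant generating function of the random point q z of K. With respect to the exponentially
  tilted distribution its gradient is the mean of q, a point of K, and its Hessian is the covariance
  matrix of q. The lower bound holds because the box contains a small ball around each p in K, where
  q z is close to p.
\<close>
lemma potential_exists:
  fixes K :: "(real^'n) set"
  assumes K: "convex K" "compact K" "K \<noteq> {}"
  shows "\<exists>\<phi> g H. potential K \<phi> g H"
proof -
  have clo: "closed K" using K compact_imp_closed by blast
  define q where "q = closest_point K"
  have qK: "q z \<in> K" for z unfolding q_def using clo K by (simp add: closest_point_in_set)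
  have q_self: "q p = p" if "p \<in> K" for p unfolding q_def using that by (simp add: closest_point_self)
  have q_lip: "dist (q y) (q z) \<le> dist y z" for y z
    unfolding q_def by (rule closest_point_lipschitz[OF K(1) clo K(3)])
  have q_cont: "continuous_on S q" for S
    unfolding q_def by (rule continuous_on_closest_point[OF K(1) clo K(3)])
  obtain r where r: "\<And>p. p \<in> K \<Longrightarrow> norm p \<le> r"
    using compact_imp_bounded[OF K(2)] unfolding bounded_iff by blast
  obtain b where b: "cball 0 (r + 1) \<subseteq> cbox (- b) (b :: real^'n)"
    using bounded_subset_cbox_symmetric[OF bounded_cball] by blast
  define I where "I f = integral (cbox (- b) b) f" for f :: "real^'n \<Rightarrow> real"
  define J where "J f = integral (cbox (- b) b) f" for f :: "real^'n \<Rightarrow> real^'n"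
  \<comment> \<open>I and J integrate over the box; e is the density of the tilted distribution, up to its total mass \<Phi>\<close>
  define e where "e x z = exp (x \<bullet> q z)" for x z
  have e_cont: "continuous_on S (e x)" for S x
    unfolding e_def by (intro continuous_intros q_cont)
  have e_pos: "e x z > 0" for x z by (simp add: e_def)
  note cont = continuous_intros e_cont q_cont
  have Iadd: "I (\<lambda>z. f z + g z) = I f + I g" if "continuous_on (cbox (- b) b) f" "continuous_on (cbox (- b) b) g" for f g
    unfolding I_def by (intro integral_add integrable_continuous that)
  have Imul: "I (\<lambda>z. c * f z) = c * I f" for c f unfolding I_def by simp
  have Ineg: "I (\<lambda>z. - f z) = - I f" for f unfolding I_def by simp
  have Inonneg: "0 \<le> I f" if "continuous_on (cbox (- b) b) f" "\<And>z. 0 \<le> f z" for f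
    unfolding I_def by (intro integral_nonneg integrable_continuous that)
  have inner_J: "h \<bullet> J f = I (\<lambda>z. h \<bullet> f z)" if "continuous_on (cbox (- b) b) f" for h f
    unfolding I_def J_def
    using integral_linear[OF integrable_continuous[OF that] bounded_linear_inner_right[of h]] by (simp add: comp_def)
  define \<Phi> where "\<Phi> x = I (e x)" for x
  define G where "G x = J (\<lambda>z. e x z *\<^sub>R q z)" for x
  have low: "\<exists>v>0. \<forall>x. \<forall>p\<in>K. v * exp (p \<bullet> x - \<epsilon> * norm x) \<le> \<Phi> x" if "\<epsilon> > 0" for \<epsilon>
  proof -
    \<comment> \<open>the radius must not exceed 1 since the box reaches only 1 beyond K\<close>
    define \<delta> where "\<delta> = min \<epsilon> 1"
    have \<delta>: "0 < \<delta>" "\<delta> \<le> \<epsilon>" "\<delta> \<le> 1" using that by (auto simp: \<delta>_def)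
    define v where "v = measure lebesgue (cball (0 :: real^'n) \<delta>)"
    have "v > 0" unfolding v_def using \<delta> content_cball_pos[of \<delta> "0 :: real^'n"] by (simp add: measure_completion)
    have "v * exp (p \<bullet> x - \<epsilon> * norm x) \<le> \<Phi> x" if p: "p \<in> K" for x p
    proof -
      have sub: "cball p \<delta> \<subseteq> cbox (- b) b"
      proof (rule subset_trans[OF _ b], rule subsetI)
        fix z assume "z \<in> cball p \<delta>"
        then have "norm (z - p) \<le> 1" using \<delta> by (simp add: dist_norm norm_minus_commute)
        then show "z \<in> cball 0 (r + 1)" using r[OF p] norm_triangle_ineq[of "z - p" p] by simp
      qed
      have bound: "exp (p \<bullet> x - \<epsilon> * norm x) \<le> e x z" if "z \<in> cball p \<delta>" for z
      proof -
        have "norm (p - q z) \<le> \<delta>"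
          using q_lip[of p z] that q_self[OF p] by (simp add: dist_norm)
        then have "(p - q z) \<bullet> x \<le> \<epsilon> * norm x"
          using norm_cauchy_schwarz[of "p - q z" x] \<delta>
          by (meson dual_order.trans mult_right_mono norm_ge_zero)
        then show ?thesis by (simp add: e_def inner_diff_left inner_commute[of x])
      qed
      have "e x absolutely_integrable_on cbox (- b) b"
        by (rule absolutely_integrable_continuous) (rule e_cont)
      then have "e x absolutely_integrable_on cball p \<delta>"
        by (rule set_integrable_subset) (use sub in auto)
      then have int: "e x integrable_on cball p \<delta>"
        by (rule set_lebesgue_integral_eq_integral(1))
      have "v * exp (p \<bullet> x - \<epsilon> * norm x) = integral (cball p \<delta>) (\<lambda>z. exp (p \<bullet> x - \<epsilon> * norm x))"
      proof -
        have "v = measure lebesgue (cball p \<delta>)"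
          using \<delta> by (simp add: v_def content_cball measure_completion)
        also have "\<dots> = integral (cball p \<delta>) (\<lambda>z. 1)" by (rule lmeasure_integral) simp
        finally show ?thesis
          using integral_mult_left[of "cball p \<delta>" "\<lambda>_. 1 :: real" "exp (p \<bullet> x - \<epsilon> * norm x)"] by simp
      qed
      also have "\<dots> \<le> integral (cball p \<delta>) (e x)"
      proof (rule integral_le[OF _ int])
        show "(\<lambda>z. exp (p \<bullet> x - \<epsilon> * norm x)) integrable_on cball p \<delta>"
          by (rule integrable_on_const) simp
      qed (rule bound)
      also have "\<dots> \<le> \<Phi> x"
        unfolding \<Phi>_def I_def
        by (rule integral_subset_le[OF sub])
          (use e_pos int in \<open>auto intro!: e_cont integrable_continuous less_imp_le\<close>)
      finally show ?thesis .
    qed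
    then show ?thesis using \<open>v > 0\<close> by blast
  qed
  have \<Phi>_pos: "\<Phi> x > 0" for x
  proof -
    obtain v where "v > 0" "\<forall>x. \<forall>p\<in>K. v * exp (p \<bullet> x - 1 * norm x) \<le> \<Phi> x"
      using low[of 1] by auto
    moreover obtain p where "p \<in> K" using K by blast
    moreover have "v * exp (p \<bullet> x - 1 * norm x) > 0" using \<open>v > 0\<close> by simp
    ultimately show ?thesis by (meson less_le_trans)
  qed
  define A where "A x h = J (\<lambda>z. (e x z * (h \<bullet> q z)) *\<^sub>R q z)" for x h
  define B where "B x h = I (\<lambda>z. e x z * (h \<bullet> q z))" for x h
  have d\<Phi>: "(\<Phi> has_derivative B x) (at x)" for x
    using exp_inner_integral_derivative[OF q_cont continuous_on_const[of _ "1 :: real"], of "- b" b x]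
    by (simp add: \<Phi>_def[abs_def] I_def B_def[abs_def] e_def[abs_def])
  have dG: "(G has_derivative A x) (at x)" for x
    using exp_inner_integral_derivative[OF q_cont q_cont, of "- b" b x]
    by (simp add: G_def[abs_def] J_def A_def[abs_def] e_def[abs_def])
  have hG: "h \<bullet> G x = B x h" for h x
    unfolding G_def B_def by (subst inner_J) (auto intro!: cont)
  have hA: "h \<bullet> A x k = I (\<lambda>z. e x z * (k \<bullet> q z) * (h \<bullet> q z))" for h k x
    unfolding A_def by (subst inner_J) (auto intro!: cont)
  define g where "g x = (1 / \<Phi> x) *\<^sub>R G x" for x
  define g' where "g' x h = (1 / \<Phi> x) *\<^sub>R A x h - (B x h / (\<Phi> x)\<^sup>2) *\<^sub>R G x" for x h
  have dg: "(g has_derivative g' x) (at x)" for x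
    unfolding g_def[abs_def] g'_def[abs_def] using \<Phi>_pos[of x]
    by (auto intro!: derivative_eq_intros dG d\<Phi> simp: power2_eq_square)
  have inner_g': "h \<bullet> g' x k = (1 / \<Phi> x) * I (\<lambda>z. e x z * (k \<bullet> q z) * (h \<bullet> q z)) - B x k * B x h / (\<Phi> x)\<^sup>2" for h k x
    by (simp add: g'_def inner_diff_right hA hG)
  define H where "H x = matrix (g' x)" for x
  have lin: "linear (g' x)" for x using dg has_derivative_linear by blast
  have "potential K (\<lambda>x. ln (\<Phi> x)) g H"
    unfolding potential_def
  proof (intro conjI allI impI)
    fix x
    have "((\<lambda>x. ln (\<Phi> x)) has_derivative (\<lambda>h. B x h / \<Phi> x)) (at x)"
      using \<Phi>_pos[of x] by (auto intro!: derivative_eq_intros d\<Phi> simp: divide_inverse)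
    moreover have "B x h / \<Phi> x = g x \<bullet> h" for h
      by (simp add: g_def hG[symmetric] inner_commute)
    ultimately show "((\<lambda>x. ln (\<Phi> x)) has_derivative (\<bullet>) (g x)) (at x)" by simp
    show "(g has_derivative (*v) (H x)) (at x)"
      unfolding H_def using dg[of x] by (simp add: matrix_works lin)
    show "psd (H x)"
      unfolding H_def
    proof (rule psd_matrixI[OF lin])
      show "h \<bullet> g' x k = k \<bullet> g' x h" for h k
        unfolding inner_g' by (simp add: mult_ac)
      fix h
      \<comment> \<open>m is the mean of h \<bullet> q z, and the next inequality is the nonnegativity of its variance\<close>
      define m where "m = B x h / \<Phi> x"
      define E2 where "E2 = I (\<lambda>z. e x z * (h \<bullet> q z) * (h \<bullet> q z))"
      have "0 \<le> I (\<lambda>z. e x z * (h \<bullet> q z - m)\<^sup>2)"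
        by (rule Inonneg) (use e_pos in \<open>auto intro!: cont simp: less_imp_le\<close>)
      also have "I (\<lambda>z. e x z * (h \<bullet> q z - m)\<^sup>2) =
          I (\<lambda>z. e x z * (h \<bullet> q z) * (h \<bullet> q z) + (- 2 * m * (e x z * (h \<bullet> q z)) + m\<^sup>2 * e x z))"
        by (rule arg_cong[where f = I]) (auto simp: power2_eq_square algebra_simps)
      also have "\<dots> = E2 + (- 2 * m * B x h + m\<^sup>2 * \<Phi> x)"
        unfolding E2_def B_def \<Phi>_def by (subst Iadd Imul, (auto intro!: cont)[2])+ (simp add: Imul Ineg mult.assoc)
      also have "\<dots> = \<Phi> x * (h \<bullet> g' x h)"
        unfolding inner_g' E2_def[symmetric] m_def using \<Phi>_pos[of x]
        by (simp add: field_simps power2_eq_square)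
      finally show "0 \<le> h \<bullet> g' x h" using \<Phi>_pos[of x] by (simp add: zero_le_mult_iff)
    qed
    show "g x \<in> K"
    proof (rule ccontr)
      assume "g x \<notin> K"
      then obtain a c where ac: "a \<bullet> g x < c" "\<And>y. y \<in> K \<Longrightarrow> a \<bullet> y > c"
        using separating_hyperplane_closed_point[OF K(1) clo] by blast
      have "0 \<le> I (\<lambda>z. e x z * (a \<bullet> q z - c))"
        by (rule Inonneg) (use e_pos ac(2)[OF qK] in \<open>auto intro!: cont simp: less_imp_le\<close>)
      also have "I (\<lambda>z. e x z * (a \<bullet> q z - c)) = I (\<lambda>z. e x z * (a \<bullet> q z) + - c * e x z)"
        by (rule arg_cong[where f = I]) (auto simp: algebra_simps)
      also have "\<dots> = B x a - c * \<Phi> x"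
        unfolding B_def \<Phi>_def by (subst Iadd) (auto intro!: cont simp: Imul Ineg)
      finally have "c \<le> a \<bullet> g x" using \<Phi>_pos[of x] by (simp add: g_def hG field_simps)
      then show False using ac(1) by simp
    qed
  next
    fix \<epsilon> :: real assume "\<epsilon> > 0"
    from low[OF this] obtain v where v: "v > 0" "\<forall>x. \<forall>p\<in>K. v * exp (p \<bullet> x - \<epsilon> * norm x) \<le> \<Phi> x"
      by blast
    have "p \<bullet> x - \<epsilon> * norm x - (- ln v) \<le> ln (\<Phi> x)" if "p \<in> K" for p x
    proof -
      have "ln (v * exp (p \<bullet> x - \<epsilon> * norm x)) \<le> ln (\<Phi> x)"
        using v(1) bspec[OF spec[OF v(2), of x] that] \<Phi>_pos[of x] by (subst ln_le_cancel_iff) auto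
      then show ?thesis using v(1) by (simp add: ln_mult)
    qed
    then show "\<exists>C. \<forall>x. \<forall>p\<in>K. p \<bullet> x - \<epsilon> * norm x - C \<le> ln (\<Phi> x)" by blast
  qed
  then show ?thesis by blast
qed

section \<open>Mixed volumes as integrals of mixed discriminants\<close>

definition compact_convex :: "(real^'n) set \<Rightarrow> bool" where
  "compact_convex K \<longleftrightarrow> convex K \<and> compact K \<and> K \<noteq> {}"

lemma compact_convex_singleton: "compact_convex {p}" by (simp add: compact_convex_def)

lemma compact_convex_scaleR: "compact_convex K \<Longrightarrow> compact_convex ((*\<^sub>R) c ` K)"
  by (auto simp: compact_convex_def compact_scaling convex_scaling)

lemma compact_convex_plus: "compact_convex K \<Longrightarrow> compact_convex L \<Longrightarrow> compact_convex (K + L)"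
proof -
  assume "compact_convex K" "compact_convex L"
  moreover have "K + L = {x + y | x y. x \<in> K \<and> y \<in> L}" by (auto simp: set_plus_def)
  ultimately have "compact (K + L)" by (simp add: compact_convex_def compact_sums)
  then show ?thesis
    using \<open>compact_convex K\<close> \<open>compact_convex L\<close> by (auto simp: compact_convex_def convex_set_plus)
qed

lemma compact_convex_sum: "finite J \<Longrightarrow> (\<And>k. k \<in> J \<Longrightarrow> compact_convex (K k)) \<Longrightarrow> compact_convex (\<Sum>k\<in>J. K k)"
  by (induction J rule: finite_induct) (auto simp: compact_convex_plus compact_convex_singleton set_zero)

text \<open>
  The polarisation of the volume. The arguments are indexed by the coordinate type, as for mixed_disc, so
  that the two alternating sums match term by term.
\<close>
definition mixed_vol :: "('n::finite \<Rightarrow> (real^'n) set) \<Rightarrow> real" where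
  "mixed_vol K =
     (\<Sum>S\<in>UNIV. (- 1) ^ (CARD('n) - card S) * measure lebesgue (\<Sum>k\<in>S. K k)) / fact CARD('n)"

lemma mixed_vol_integral:
  fixes K :: "'n::finite \<Rightarrow> (real^'n) set"
  assumes compact_convex: "\<And>k. compact_convex (K k)" and pot: "\<And>k. potential (K k) (\<phi> k) (g k) (H k)"
  shows "((\<lambda>x. mixed_disc (\<lambda>k. H k x)) has_integral fact CARD('n) * mixed_vol K) UNIV"
proof -
  have "((\<lambda>x. \<Sum>S\<in>UNIV. (- 1) ^ (CARD('n) - card S) * det (\<Sum>k\<in>S. H k x)) has_integral
     (\<Sum>S\<in>UNIV. (- 1) ^ (CARD('n) - card S) * measure lebesgue (\<Sum>k\<in>S. K k))) UNIV"
  proof (intro has_integral_sum has_integral_mult_right finite)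
    fix S :: "'n set"
    have "compact_convex (\<Sum>k\<in>S. K k)" by (rule compact_convex_sum) (simp_all add: compact_convex)
    then show "((\<lambda>x. det (\<Sum>k\<in>S. H k x)) has_integral measure lebesgue (\<Sum>k\<in>S. K k)) UNIV"
      using potential_det_integral[OF _ _ potential_sum[OF finite pot, where J = S]] by (auto simp: compact_convex_def)
  qed
  then show ?thesis by (simp add: mixed_vol_def mixed_disc_polarization)
qed

lemma potential_family:
  assumes "\<And>k. compact_convex (K k)"
  obtains \<phi> g H where "\<And>k. potential (K k) (\<phi> k) (g k) (H k)"
proof -
  have "\<forall>k. \<exists>t. potential (K k) (fst t) (fst (snd t)) (snd (snd t))"
    using potential_exists assms unfolding compact_convex_def by (metis fst_conv snd_conv)
  then obtain t where "\<forall>k. potential (K k) (fst (t k)) (fst (snd (t k))) (snd (snd (t k)))"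
    by (rule choice[THEN exE])
  then show ?thesis
    using that[of "\<lambda>k. fst (t k)" "\<lambda>k. fst (snd (t k))" "\<lambda>k. snd (snd (t k))"] by blast
qed

lemma mixed_vol_upd_integral:
  fixes K :: "'n::finite \<Rightarrow> (real^'n) set"
  assumes "\<And>k. compact_convex (K k)" "\<And>k. potential (K k) (\<phi> k) (g k) (H k)"
    and "compact_convex X" "potential X u gu Hu"
  shows "((\<lambda>x. mixed_disc ((\<lambda>j. H j x)(k := Hu x))) has_integral fact CARD('n) * mixed_vol (K(k := X))) UNIV"
proof -
  have "((\<lambda>x. mixed_disc (\<lambda>j. (H(k := Hu)) j x)) has_integral fact CARD('n) * mixed_vol (K(k := X))) UNIV"
    by (rule mixed_vol_integral[where \<phi> = "\<phi>(k := u)" and g = "g(k := gu)"]) (use assms in auto)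
  moreover have "(\<lambda>j. (H(k := Hu)) j x) = (\<lambda>j. H j x)(k := Hu x)" for x by auto
  ultimately show ?thesis by simp
qed

lemma mixed_vol_linear:
  fixes K :: "'n::finite \<Rightarrow> (real^'n) set"
  assumes K: "\<And>k. compact_convex (K k)" and A: "compact_convex A" and B: "compact_convex B" and ab: "0 \<le> a" "0 \<le> b"
  shows "mixed_vol (K(k := (*\<^sub>R) a ` A + (*\<^sub>R) b ` B)) = a * mixed_vol (K(k := A)) + b * mixed_vol (K(k := B))"
proof -
  obtain \<phi> g H where pot: "\<And>k. potential (K k) (\<phi> k) (g k) (H k)"
    using potential_family[of K] K by blast
  obtain uA gA HA where potA: "potential A uA gA HA" using potential_exists A unfolding compact_convex_def by blast
  obtain uB gB HB where potB: "potential B uB gB HB" using potential_exists B unfolding compact_convex_def by blast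
  let ?n = "fact CARD('n) :: real"
  have "((\<lambda>x. mixed_disc ((\<lambda>j. H j x)(k := a *\<^sub>R HA x + b *\<^sub>R HB x))) has_integral
      ?n * mixed_vol (K(k := (*\<^sub>R) a ` A + (*\<^sub>R) b ` B))) UNIV"
    by (rule mixed_vol_upd_integral[OF K pot compact_convex_plus[OF compact_convex_scaleR[OF A] compact_convex_scaleR[OF B]]
          potential_add[OF potential_scaleR[OF potA ab(1)] potential_scaleR[OF potB ab(2)]]])
  moreover have "((\<lambda>x. mixed_disc ((\<lambda>j. H j x)(k := a *\<^sub>R HA x + b *\<^sub>R HB x))) has_integral
      a * (?n * mixed_vol (K(k := A))) + b * (?n * mixed_vol (K(k := B)))) UNIV"
    unfolding mixed_disc_linear
    by (intro has_integral_add has_integral_mult_right mixed_vol_upd_integral[OF K pot A potA]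
        mixed_vol_upd_integral[OF K pot B potB])
  ultimately have "?n * mixed_vol (K(k := (*\<^sub>R) a ` A + (*\<^sub>R) b ` B)) =
      a * (?n * mixed_vol (K(k := A))) + b * (?n * mixed_vol (K(k := B)))"
    by (rule has_integral_unique)
  also have "\<dots> = ?n * (a * mixed_vol (K(k := A)) + b * mixed_vol (K(k := B)))"
    by (simp only: distrib_left mult.left_commute)
  finally show ?thesis by (simp only: mult_cancel_left) simp
qed

text \<open>
  A point has a linear potential, whose Hessian is zero.
\<close>
lemma mixed_vol_singleton:
  fixes K :: "'n::finite \<Rightarrow> (real^'n) set"
  assumes K: "\<And>k. compact_convex (K k)"
  shows "mixed_vol (K(k := {p})) = 0"
proof -
  obtain \<phi> g H where pot: "\<And>k. potential (K k) (\<phi> k) (g k) (H k)"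
    using potential_family[of K] K by blast
  have "((\<lambda>x :: real^'n. 0 :: real) has_integral fact CARD('n) * mixed_vol (K(k := {p}))) UNIV"
    using mixed_vol_upd_integral[of K \<phi> g H "{p}" "\<lambda>x. p \<bullet> x" "\<lambda>x. p" "\<lambda>x. 0" k, OF K pot compact_convex_singleton potential_singleton]
    unfolding mixed_disc_zero by blast
  then show ?thesis using has_integral_unique[OF _ has_integral_0] by force
qed

lemma mixed_vol_permute:
  fixes K :: "'n::finite \<Rightarrow> (real^'n) set"
  assumes K: "\<And>k. compact_convex (K k)" and p: "p permutes UNIV"
  shows "mixed_vol (K \<circ> p) = mixed_vol K"
proof -
  obtain \<phi> g H where pot: "\<And>k. potential (K k) (\<phi> k) (g k) (H k)"
    using potential_family[of K] K by blast
  have "((\<lambda>x. mixed_disc ((\<lambda>k. H k x) \<circ> p)) has_integral fact CARD('n) * mixed_vol (K \<circ> p)) UNIV"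
    using mixed_vol_integral[of "K \<circ> p" "\<phi> \<circ> p" "g \<circ> p" "H \<circ> p"] K pot by (simp add: comp_def)
  then have "((\<lambda>x. mixed_disc (\<lambda>k. H k x)) has_integral fact CARD('n) * mixed_vol (K \<circ> p)) UNIV"
    unfolding mixed_disc_permute[OF p] .
  from has_integral_unique[OF this mixed_vol_integral[OF K pot]] show ?thesis by simp
qed

lemma mixed_vol_const:
  fixes K :: "(real^'n) set"
  assumes K: "compact_convex K"
  shows "mixed_vol (\<lambda>_. K) = measure lebesgue K"
proof -
  obtain \<phi> g H where pot: "potential K \<phi> g H"
    using potential_exists K unfolding compact_convex_def by blast
  have "((\<lambda>x. fact CARD('n) * det (H x)) has_integral fact CARD('n) * mixed_vol (\<lambda>_ :: 'n. K)) UNIV"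
    using mixed_vol_integral[of "\<lambda>_. K" "\<lambda>_. \<phi>" "\<lambda>_. g" "\<lambda>_. H"] K pot by (simp add: mixed_disc_const)
  moreover have "((\<lambda>x. fact CARD('n) * det (H x)) has_integral fact CARD('n) * measure lebesgue K) UNIV"
    using K by (intro has_integral_mult_right potential_det_integral[OF _ _ pot]) (auto simp: compact_convex_def)
  ultimately have "(fact CARD('n) :: real) * mixed_vol (\<lambda>_ :: 'n. K) = fact CARD('n) * measure lebesgue K"
    by (rule has_integral_unique)
  then show ?thesis by simp
qed

lemma measure_minkowski_combination:
  fixes K :: "'n::finite \<Rightarrow> (real^'n) set"
  assumes K: "\<And>k. compact_convex (K k)" and c: "\<And>k. 0 \<le> c k"
  shows "measure lebesgue (\<Sum>k\<in>UNIV. (*\<^sub>R) (c k) ` K k) =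
     (\<Sum>f\<in>UNIV. (\<Prod>i\<in>UNIV. c (f i)) * mixed_vol (K \<circ> f))"
proof -
  obtain \<phi> g H where pot: "\<And>k. potential (K k) (\<phi> k) (g k) (H k)"
    using potential_family[of K] K by blast
  let ?n = "fact CARD('n) :: real"
  have compact_convex: "compact_convex (\<Sum>k\<in>UNIV. (*\<^sub>R) (c k) ` K k)" by (intro compact_convex_sum compact_convex_scaleR K) simp
  have "((\<lambda>x. ?n * det (\<Sum>k\<in>UNIV. c k *\<^sub>R H k x)) has_integral
     ?n * measure lebesgue (\<Sum>k\<in>UNIV. (*\<^sub>R) (c k) ` K k)) UNIV"
    using compact_convex
    by (intro has_integral_mult_right
        potential_det_integral[OF _ _ potential_sum[OF finite potential_scaleR[OF pot c], where J = UNIV]])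
      (auto simp: compact_convex_def)
  moreover have "((\<lambda>x. ?n * det (\<Sum>k\<in>UNIV. c k *\<^sub>R H k x)) has_integral
     (\<Sum>f\<in>UNIV. (\<Prod>i\<in>UNIV. c (f i)) * (?n * mixed_vol (K \<circ> f)))) UNIV"
    unfolding det_sum_scaleR_mixed_disc
  proof (intro has_integral_sum has_integral_mult_right finite)
    fix f :: "'n \<Rightarrow> 'n"
    show "((\<lambda>x. mixed_disc ((\<lambda>k. H k x) \<circ> f)) has_integral ?n * mixed_vol (K \<circ> f)) UNIV"
      using mixed_vol_integral[of "K \<circ> f" "\<phi> \<circ> f" "g \<circ> f" "H \<circ> f"] K pot by (simp add: comp_def)
  qed
  ultimately have "?n * measure lebesgue (\<Sum>k\<in>UNIV. (*\<^sub>R) (c k) ` K k) =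
     (\<Sum>f\<in>UNIV. (\<Prod>i\<in>UNIV. c (f i)) * (?n * mixed_vol (K \<circ> f)))"
    by (rule has_integral_unique)
  also have "\<dots> = ?n * (\<Sum>f\<in>UNIV. (\<Prod>i\<in>UNIV. c (f i)) * mixed_vol (K \<circ> f))"
    by (simp only: sum_distrib_left mult.left_commute)
  finally show ?thesis by (simp only: mult_cancel_left) simp
qed

text \<open>
  The functions W m are Hessians of potentials of the larger set M, hence all give the mixed volume with M, and
  they converge pointwise to the Hessian for L.
\<close>
lemma mixed_vol_mono:
  fixes K :: "'n::finite \<Rightarrow> (real^'n) set"
  assumes K: "\<And>k. compact_convex (K k)" and L: "compact_convex L" and M: "compact_convex M" and sub: "L \<subseteq> M"
  shows "mixed_vol (K(k := L)) \<le> mixed_vol (K(k := M))"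
proof -
  obtain \<phi> g H where pot: "\<And>k. potential (K k) (\<phi> k) (g k) (H k)"
    using potential_family[of K] K by blast
  obtain u gu Hu where potL: "potential L u gu Hu" using potential_exists L unfolding compact_convex_def by blast
  obtain v gv Hv where potM: "potential M v gv Hv" using potential_exists M unfolding compact_convex_def by blast
  let ?n = "fact CARD('n) :: real"
  define \<theta> where "\<theta> m x = 1 / (1 + 1 / Suc m * exp (v x - u x))" for m x
  define W where "W m x = \<theta> m x *\<^sub>R Hu x + (1 - \<theta> m x) *\<^sub>R Hv x + (\<theta> m x * (1 - \<theta> m x)) *\<^sub>R rank_one (gv x - gu x)" for m x
  have potW: "potential M (\<lambda>x. u x + ln (1 + 1 / Suc m * exp (v x - u x)))
     (\<lambda>x. \<theta> m x *\<^sub>R gu x + (1 - \<theta> m x) *\<^sub>R gv x) (W m)" for m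
    unfolding W_def \<theta>_def using M
    by (intro potential_ln_add_exp[OF potL potM sub]) (auto simp: compact_convex_def)
  define D where "D X x = mixed_disc ((\<lambda>j. H j x)(k := X))" for X x
  have D_nonneg: "0 \<le> D X x" if "psd X" for X x
    unfolding D_def by (rule mixed_disc_nonneg) (use that pot in \<open>auto simp: potential_def\<close>)
  have Wnn: "0 \<le> D (W m x) x" for m x by (rule D_nonneg) (use potW in \<open>simp add: potential_def\<close>)
  have Unn: "0 \<le> D (Hu x) x" for x by (rule D_nonneg) (use potL in \<open>simp add: potential_def\<close>)
  have "((\<lambda>x. D (W m x) x) has_integral ?n * mixed_vol (K(k := M))) UNIV" for m
    unfolding D_def by (rule mixed_vol_upd_integral[OF K pot M potW])
  then have W: "(\<lambda>x. D (W m x) x) \<in> borel_measurable lebesgue"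
    "(\<integral>\<^sup>+x. D (W m x) x \<partial>lebesgue) = ?n * mixed_vol (K(k := M))" for m
    unfolding has_integral_iff_nn_integral_lebesgue[OF Wnn] by auto
  have "((\<lambda>x. D (Hu x) x) has_integral ?n * mixed_vol (K(k := L))) UNIV"
    unfolding D_def by (rule mixed_vol_upd_integral[OF K pot L potL])
  then have U: "(\<integral>\<^sup>+x. D (Hu x) x \<partial>lebesgue) = ?n * mixed_vol (K(k := L))"
    unfolding has_integral_iff_nn_integral_lebesgue[OF Unn] by auto
  have lim: "(\<lambda>m. D (W m x) x) \<longlonglongrightarrow> D (Hu x) x" for x
  proof -
    have DW: "D (W m x) x = \<theta> m x * D (Hu x) x + (1 - \<theta> m x) * D (Hv x) x
        + \<theta> m x * (1 - \<theta> m x) * D (rank_one (gv x - gu x)) x" for m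
    proof -
      have "D (1 *\<^sub>R (\<theta> m x *\<^sub>R Hu x + (1 - \<theta> m x) *\<^sub>R Hv x) + (\<theta> m x * (1 - \<theta> m x)) *\<^sub>R rank_one (gv x - gu x)) x
         = 1 * D (\<theta> m x *\<^sub>R Hu x + (1 - \<theta> m x) *\<^sub>R Hv x) x + \<theta> m x * (1 - \<theta> m x) * D (rank_one (gv x - gu x)) x"
        unfolding D_def by (rule mixed_disc_linear)
      moreover have "D (\<theta> m x *\<^sub>R Hu x + (1 - \<theta> m x) *\<^sub>R Hv x) x = \<theta> m x * D (Hu x) x + (1 - \<theta> m x) * D (Hv x) x"
        unfolding D_def by (rule mixed_disc_linear)
      ultimately show ?thesis by (simp add: W_def)
    qed
    have "(\<lambda>m. 1 / real (Suc m)) \<longlonglongrightarrow> 0" using LIMSEQ_inverse_real_of_nat by (simp add: inverse_eq_divide)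
    then have "(\<lambda>m. \<theta> m x) \<longlonglongrightarrow> 1 / (1 + 0 * exp (v x - u x))"
      unfolding \<theta>_def by (intro tendsto_intros) auto
    then have "(\<lambda>m. \<theta> m x) \<longlonglongrightarrow> 1" by simp
    then have "(\<lambda>m. D (W m x) x) \<longlonglongrightarrow> 1 * D (Hu x) x + (1 - 1) * D (Hv x) x
        + 1 * (1 - 1) * D (rank_one (gv x - gu x)) x"
      unfolding DW by (intro tendsto_intros)
    then show ?thesis by simp
  qed
  have "ennreal (?n * mixed_vol (K(k := L))) = (\<integral>\<^sup>+x. liminf (\<lambda>m. ennreal (D (W m x) x)) \<partial>lebesgue)"
    unfolding U[symmetric]
    by (intro nn_integral_cong lim_imp_Liminf[symmetric] tendsto_ennrealI lim) simp
  also have "\<dots> \<le> liminf (\<lambda>m. \<integral>\<^sup>+x. ennreal (D (W m x) x) \<partial>lebesgue)"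
    by (rule nn_integral_liminf) (use W(1) in simp)
  also have "\<dots> = ennreal (?n * mixed_vol (K(k := M)))"
    unfolding W(2) by (simp add: Liminf_const)
  finally have "ennreal (?n * mixed_vol (K(k := L))) \<le> ennreal (?n * mixed_vol (K(k := M)))" .
  moreover have "0 \<le> ?n * mixed_vol (K(k := M))"
    by (rule has_integral_nonneg[OF mixed_vol_upd_integral[OF K pot M potM]])
      (use D_nonneg[of "Hv x" x for x] potM in \<open>simp add: D_def potential_def\<close>)
  ultimately have "?n * mixed_vol (K(k := L)) \<le> ?n * mixed_vol (K(k := M))"
    by (simp only: ennreal_le_iff)
  then show ?thesis by simp
qed

section \<open>Existence and uniqueness of the mixed volume functional\<close>

text \<open>
  An enumeration of the coordinate type translates between lists of n sets and families indexed by
  coordinates.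
\<close>
definition slot :: "'n::finite \<Rightarrow> nat" where
  "slot = (SOME e. bij_betw e UNIV {..<CARD('n)})"

lemma slot_bij: "bij_betw (slot :: 'n::finite \<Rightarrow> nat) UNIV {..<CARD('n)}"
proof -
  have "\<exists>e :: 'n \<Rightarrow> nat. bij_betw e UNIV {..<CARD('n)}"
    using ex_bij_betw_finite_nat[of "UNIV :: 'n set"] by (simp add: atLeast0LessThan)
  then show ?thesis unfolding slot_def by (rule someI_ex)
qed

definition index_of_slot :: "nat \<Rightarrow> 'n::finite" where
  "index_of_slot = inv_into UNIV slot"

lemma slot_less: "slot (k :: 'n::finite) < CARD('n)"
  using slot_bij[where 'n = 'n] by (auto simp: bij_betw_def)

lemma index_of_slot_slot: "index_of_slot (slot k) = k"
  unfolding index_of_slot_def by (rule inv_f_f) (use slot_bij in \<open>auto simp: bij_betw_def\<close>)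

lemma slot_index_of_slot: "i < CARD('n) \<Longrightarrow> slot (index_of_slot i :: 'n::finite) = i"
  unfolding index_of_slot_def by (rule f_inv_into_f) (use slot_bij[where 'n = 'n] in \<open>auto simp: bij_betw_def\<close>)

lemma slot_eq_iff: "slot k = slot l \<longleftrightarrow> k = l"
  by (metis index_of_slot_slot)

definition mixed_vol_list :: "(real^'n) set list \<Rightarrow> real" where
  "mixed_vol_list Ks = mixed_vol (\<lambda>k. Ks ! slot k)"

lemma tuples_iff:
  "(Ks :: (real^'n) set list) \<in> compact_convex_tuples \<longleftrightarrow> length Ks = CARD('n) \<and> (\<forall>K\<in>set Ks. compact_convex K)"
  by (simp add: compact_convex_tuples_def compact_convex_def)

lemma tuples_nth:
  "(Ks :: (real^'n) set list) \<in> compact_convex_tuples \<Longrightarrow> compact_convex (Ks ! slot (k :: 'n))"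
  by (simp add: tuples_iff slot_less)

lemma mixed_vol_list_cong_mset:
  fixes Ks :: "(real^'n) set list"
  assumes Ks: "Ks \<in> compact_convex_tuples" and m: "mset Ks' = mset Ks"
  shows "mixed_vol_list Ks' = mixed_vol_list Ks"
proof -
  obtain p where p: "p permutes {..<length Ks}" "permute_list p Ks = Ks'"
    using mset_eq_permutation[OF m] by blast
  have len: "length Ks = CARD('n)" using Ks by (simp add: tuples_iff)
  define \<pi> where "\<pi> k = (index_of_slot (p (slot k)) :: 'n)" for k :: 'n
  have less: "p (slot (k :: 'n)) < CARD('n)" for k
    using permutes_in_image[OF p(1), of "slot k"] slot_less[of k] len by simp
  have "inj \<pi>"
    using less slot_index_of_slot permutes_inj[OF p(1)] slot_eq_iff
    unfolding inj_def \<pi>_def by metis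
  then have "\<pi> permutes UNIV"
    by (intro bij_imp_permutes) (auto simp: bij_def finite_UNIV_inj_surj)
  moreover have "(\<lambda>k. Ks' ! slot k) = (\<lambda>k. Ks ! slot k) \<circ> \<pi>"
    using permute_list_nth[OF p(1)] p(2) slot_less[where 'n = 'n] len less
    by (auto simp: \<pi>_def slot_index_of_slot fun_eq_iff)
  ultimately show ?thesis
    unfolding mixed_vol_list_def using mixed_vol_permute[of "\<lambda>k. Ks ! slot k" \<pi>] tuples_nth[OF Ks] by simp
qed

lemma mixed_vol_list_linear:
  fixes K M :: "(real^'n) set"
  assumes K: "Ks @ [K] @ Ks' \<in> compact_convex_tuples" and M: "Ks @ [M] @ Ks' \<in> compact_convex_tuples"
    and ab: "0 \<le> a" "0 \<le> b"
  shows "mixed_vol_list (Ks @ [(*\<^sub>R) a ` K + (*\<^sub>R) b ` M] @ Ks') =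
     a * mixed_vol_list (Ks @ [K] @ Ks') + b * mixed_vol_list (Ks @ [M] @ Ks')"
proof -
  define l where "l = (index_of_slot (length Ks) :: 'n)"
  have "length Ks < CARD('n)" using K by (simp add: tuples_iff)
  then have l: "slot l = length Ks" by (simp add: l_def slot_index_of_slot)
  have upd: "(\<lambda>k :: 'n. (Ks @ [X] @ Ks') ! slot k) = (\<lambda>k. (Ks @ [K] @ Ks') ! slot k)(l := X)" for X
  proof
    fix k :: 'n
    show "(Ks @ [X] @ Ks') ! slot k = ((\<lambda>k. (Ks @ [K] @ Ks') ! slot k)(l := X)) k"
    proof (cases "k = l")
      case True
      then show ?thesis using l by (simp add: nth_append)
    next
      case False
      then have "slot k \<noteq> length Ks" using l slot_eq_iff by metis
      then show ?thesis using False by (simp add: nth_append nth_Cons')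
    qed
  qed
  have "compact_convex K" "compact_convex M" using K M by (auto simp: tuples_iff)
  then show ?thesis
    using mixed_vol_linear[of "\<lambda>k. (Ks @ [K] @ Ks') ! slot k" K M a b l] tuples_nth[OF K] ab
    unfolding mixed_vol_list_def upd[of M] upd[of "(*\<^sub>R) a ` K + (*\<^sub>R) b ` M"]
    by (simp only: upd[of K, symmetric])
qed

lemma sum_lists_eq_sum_functions:
  fixes F :: "nat list \<Rightarrow> real"
  shows "(\<Sum>is | length is = CARD('n) \<and> set is \<subseteq> {..<CARD('n)}. F is) =
     (\<Sum>f\<in>UNIV. F (map (\<lambda>j. slot (f (index_of_slot j :: 'n) :: 'n::finite)) [0..<CARD('n)]))"
proof (rule sum.reindex_bij_witness[of _ "\<lambda>f. map (\<lambda>j. slot (f (index_of_slot j :: 'n) :: 'n)) [0..<CARD('n)]"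
      "\<lambda>is k. index_of_slot (is ! slot (k :: 'n)) :: 'n"])
  fix "is" assume "is \<in> {is. length is = CARD('n) \<and> set is \<subseteq> {..<CARD('n)}}"
  then have len: "length is = CARD('n)" and sub: "set is \<subseteq> {..<CARD('n)}" by simp_all
  have js: "is ! j < CARD('n)" if "j < CARD('n)" for j
    using subsetD[OF sub nth_mem] len that by simp
  show *: "map (\<lambda>j. slot (index_of_slot (is ! slot (index_of_slot j :: 'n)) :: 'n)) [0..<CARD('n)] = is"
    by (rule nth_equalityI) (simp_all add: len slot_index_of_slot js)
  show "F (map (\<lambda>j. slot (index_of_slot (is ! slot (index_of_slot j :: 'n)) :: 'n)) [0..<CARD('n)]) = F is"
    unfolding * ..
next
  fix f :: "'n \<Rightarrow> 'n"
  show "(\<lambda>k. index_of_slot (map (\<lambda>j. slot (f (index_of_slot j))) [0..<CARD('n)] ! slot k)) = f"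
    by (rule ext) (simp add: slot_less index_of_slot_slot)
qed (auto simp: slot_less)

lemma mixed_vol_list_polynomial:
  fixes Ks :: "(real^'n) set list"
  assumes Ks: "Ks \<in> compact_convex_tuples" and c: "\<And>i. i < CARD('n) \<Longrightarrow> 0 \<le> c i"
  shows "measure lebesgue (\<Sum>i<CARD('n). (*\<^sub>R) (c i) ` (Ks ! i)) =
    (\<Sum>is | length is = CARD('n) \<and> set is \<subseteq> {..<CARD('n)}.
       (\<Prod>j<CARD('n). c (is ! j)) * mixed_vol_list (map ((!) Ks) is))"
proof -
  let ?K = "\<lambda>k :: 'n. Ks ! slot k"
  have "(\<Sum>i<CARD('n). (*\<^sub>R) (c i) ` (Ks ! i)) = (\<Sum>k\<in>UNIV. (*\<^sub>R) (c (slot k)) ` ?K k)"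
    using sum.reindex_bij_betw[OF slot_bij[where 'n = 'n], of "\<lambda>i. (*\<^sub>R) (c i) ` (Ks ! i)"] by simp
  then have "measure lebesgue (\<Sum>i<CARD('n). (*\<^sub>R) (c i) ` (Ks ! i)) =
     (\<Sum>f\<in>UNIV. (\<Prod>k\<in>UNIV. c (slot (f k))) * mixed_vol (?K \<circ> f))"
    using measure_minkowski_combination[of ?K "\<lambda>k. c (slot k)"] tuples_nth[OF Ks] c slot_less[where 'n = 'n] by simp
  also have "\<dots> = (\<Sum>f\<in>UNIV. (\<Prod>j<CARD('n). c (map (\<lambda>j. slot (f (index_of_slot j :: 'n) :: 'n)) [0..<CARD('n)] ! j)) *
       mixed_vol_list (map ((!) Ks) (map (\<lambda>j. slot (f (index_of_slot j :: 'n) :: 'n)) [0..<CARD('n)])))"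
  proof (rule sum.cong[OF refl])
    fix f :: "'n \<Rightarrow> 'n"
    have "(\<Prod>j<CARD('n). c (map (\<lambda>j. slot (f (index_of_slot j :: 'n) :: 'n)) [0..<CARD('n)] ! j)) = (\<Prod>k\<in>UNIV. c (slot (f k)))"
      using prod.reindex_bij_betw[OF slot_bij[where 'n = 'n], of "\<lambda>j. c (slot (f (index_of_slot j)))"]
      by (simp add: index_of_slot_slot)
    moreover have "mixed_vol_list (map ((!) Ks) (map (\<lambda>j. slot (f (index_of_slot j :: 'n) :: 'n)) [0..<CARD('n)])) = mixed_vol (?K \<circ> f)"
      unfolding mixed_vol_list_def by (rule arg_cong[where f = mixed_vol]) (simp add: slot_less index_of_slot_slot comp_def)
    ultimately show "(\<Prod>k\<in>UNIV. c (slot (f k))) * mixed_vol (?K \<circ> f) =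
       (\<Prod>j<CARD('n). c (map (\<lambda>j. slot (f (index_of_slot j :: 'n) :: 'n)) [0..<CARD('n)] ! j)) *
       mixed_vol_list (map ((!) Ks) (map (\<lambda>j. slot (f (index_of_slot j :: 'n) :: 'n)) [0..<CARD('n)]))" by simp
  qed
  finally show ?thesis
    using sum_lists_eq_sum_functions[where 'n = 'n,
      of "\<lambda>is. (\<Prod>j<CARD('n). c (is ! j)) * mixed_vol_list (map ((!) Ks) is)"] by simp
qed

lemma mixed_volume_functional_mixed_vol_list: "mixed_volume_functional mixed_vol_list"
  unfolding mixed_volume_functional_def
  using mixed_vol_list_cong_mset mixed_vol_list_linear mixed_vol_list_polynomial by blast

text \<open>
  The right side does not mention V, so this shows the uniqueness of the mixed volume. The lists that
  involve each index are the n! orderings of Ks, on which V has the same value by symmetry.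
\<close>
lemma mixed_volume_functional_polarization:
  fixes Ks :: "(real^'n) set list"
  assumes V: "mixed_volume_functional V" and Ks: "Ks \<in> compact_convex_tuples"
  shows "fact CARD('n) * V Ks = (\<Sum>S\<in>Pow {..<CARD('n)}. (- 1) ^ (CARD('n) - card S) *
     measure lebesgue (\<Sum>i<CARD('n). (*\<^sub>R) (of_bool (i \<in> S)) ` (Ks ! i)))"
proof -
  let ?n = "CARD('n)"
  define T where "T = {is. length is = ?n \<and> set is \<subseteq> {..<?n}}"
  have finT: "finite T"
    unfolding T_def using finite_lists_length_eq[of "{..<?n}" ?n] by (simp add: conj_commute)
  have len: "length Ks = ?n" using Ks by (simp add: tuples_iff)
  have "(\<Sum>S\<in>Pow {..<?n}. (- 1) ^ (?n - card S) *
     measure lebesgue (\<Sum>i<?n. (*\<^sub>R) (of_bool (i \<in> S)) ` (Ks ! i))) =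
    (\<Sum>S\<in>Pow {..<?n}. (- 1) ^ (card {..<?n} - card S) *
       (\<Sum>is | is \<in> T \<and> set is \<subseteq> S. V (map ((!) Ks) is)))"
  proof (rule sum.cong[OF refl])
    fix S assume "S \<in> Pow {..<?n}"
    have "measure lebesgue (\<Sum>i<?n. (*\<^sub>R) (of_bool (i \<in> S)) ` (Ks ! i)) =
       (\<Sum>is\<in>T. (\<Prod>j<?n. of_bool (is ! j \<in> S)) * V (map ((!) Ks) is))"
      using V Ks unfolding mixed_volume_functional_def T_def by simp
    also have "\<dots> = (\<Sum>is\<in>T. if set is \<subseteq> S then V (map ((!) Ks) is) else 0)"
    proof (rule sum.cong[OF refl])
      fix "is" assume "is \<in> T"
      then have "length is = ?n" by (simp add: T_def)
      then have "set is \<subseteq> S \<longleftrightarrow> (\<forall>j<?n. is ! j \<in> S)" by (simp add: subset_code(1) all_set_conv_all_nth)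
      then have "(\<Prod>j<?n. of_bool (is ! j \<in> S)) = (of_bool (set is \<subseteq> S) :: real)"
        by (auto intro!: prod_zero)
      then show "(\<Prod>j<?n. of_bool (is ! j \<in> S)) * V (map ((!) Ks) is) = (if set is \<subseteq> S then V (map ((!) Ks) is) else 0)"
        by simp
    qed
    also have "\<dots> = (\<Sum>is | is \<in> T \<and> set is \<subseteq> S. V (map ((!) Ks) is))"
      using finT by (simp add: sum.inter_filter)
    finally show "(- 1) ^ (?n - card S) * measure lebesgue (\<Sum>i<?n. (*\<^sub>R) (of_bool (i \<in> S)) ` (Ks ! i)) =
      (- 1) ^ (card {..<?n} - card S) * (\<Sum>is | is \<in> T \<and> set is \<subseteq> S. V (map ((!) Ks) is))" by simp
  qed
  also have "\<dots> = (\<Sum>is | is \<in> T \<and> set is = {..<?n}. V (map ((!) Ks) is))"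
    by (rule inclusion_exclusion_support) (use finT in \<open>auto simp: T_def\<close>)
  also have "\<dots> = (\<Sum>is | is \<in> T \<and> set is = {..<?n}. V Ks)"
  proof (rule sum.cong[OF refl])
    fix "is" assume "is \<in> {is. is \<in> T \<and> set is = {..<?n}}"
    then have js: "length is = ?n" "set is = {..<?n}" by (auto simp: T_def)
    then have "distinct is" by (intro card_distinct) simp
    then have "mset is = mset [0..<?n]"
      using js set_eq_iff_mset_eq_distinct[of "is" "[0..<?n]"] by (simp add: atLeast0LessThan)
    then have "mset (map ((!) Ks) is) = mset (map ((!) Ks) [0..<?n])" by (simp only: mset_map)
    also have "map ((!) Ks) [0..<?n] = Ks" using map_nth[of Ks] len by simp
    finally show "V (map ((!) Ks) is) = V Ks"
      using V Ks unfolding mixed_volume_functional_def by blast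
  qed
  also have "\<dots> = card {is. is \<in> T \<and> set is = {..<?n}} * V Ks" by simp
  also have "{is. is \<in> T \<and> set is = {..<?n}} = {is. length is = ?n \<and> distinct is \<and> set is \<subseteq> {..<?n}}"
  proof (intro Collect_cong iffI conjI)
    fix "is" assume "is \<in> T \<and> set is = {..<?n}"
    then show "length is = ?n" "set is \<subseteq> {..<?n}" "distinct is"
      by (simp_all add: T_def card_distinct)
  next
    fix "is" assume *: "length is = ?n \<and> distinct is \<and> set is \<subseteq> {..<?n}"
    then show "is \<in> T" by (simp add: T_def)
    show "set is = {..<?n}"
      by (rule card_subset_eq) (use * in \<open>simp_all add: distinct_card\<close>)
  qed
  also have "card \<dots> = fact ?n"
    by (subst card_lists_distinct_length_eq) (auto simp: fact_prod)
  finally show ?thesis by simp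
qed

lemma mixed_volume_eq_mixed_vol_list:
  fixes Ks :: "(real^'n) set list"
  assumes "Ks \<in> compact_convex_tuples"
  shows "mixed_volume Ks = mixed_vol_list Ks"
  unfolding mixed_volume_def
proof (rule the_equality)
  show "\<exists>V. mixed_volume_functional V \<and> V Ks = mixed_vol_list Ks"
    using mixed_volume_functional_mixed_vol_list by blast
  fix v assume "\<exists>V. mixed_volume_functional V \<and> V Ks = v"
  then obtain V where V: "mixed_volume_functional V" "V Ks = v" by blast
  have "fact CARD('n) * V Ks = fact CARD('n) * mixed_vol_list Ks"
    using mixed_volume_functional_polarization[OF V(1) assms]
      mixed_volume_functional_polarization[OF mixed_volume_functional_mixed_vol_list assms] by simp
  then show "v = mixed_vol_list Ks" using V(2) by simp
qed

section \<open>The first variation of volume\<close>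

lemma mixed_vol_nonneg:
  fixes K :: "'n::finite \<Rightarrow> (real^'n) set"
  assumes K: "\<And>k. compact_convex (K k)"
  shows "0 \<le> mixed_vol K"
proof -
  fix k :: 'n
  obtain p where "p \<in> K k" using K[of k] by (auto simp: compact_convex_def)
  then have "mixed_vol (K(k := {p})) \<le> mixed_vol (K(k := K k))"
    by (intro mixed_vol_mono K compact_convex_singleton) auto
  then show ?thesis using mixed_vol_singleton[OF K] by simp
qed

text \<open>
  Generalises minkowski_first_variation to a subset T of the arguments so that induction on T works: the linearity in
  a further argument k splits off \<epsilon> times a mixed volume in which only the arguments in T depend on \<epsilon>, and
  which is continuous at 0 by the induction hypothesis.
\<close>
lemma mixed_vol_partial_right_derivative:
  fixes M :: "'n::finite \<Rightarrow> (real^'n) set"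
  assumes K: "compact_convex K" and L: "compact_convex L" and M: "\<And>k. compact_convex (M k)"
  shows "((\<lambda>\<epsilon>. mixed_vol (\<lambda>j. if j \<in> T then K + (*\<^sub>R) \<epsilon> ` L else M j)) has_real_derivative
     (\<Sum>k\<in>T. mixed_vol ((\<lambda>j. if j \<in> T then K else M j)(k := L)))) (at 0 within {0..})"
  using finite[of T] M
proof (induction T arbitrary: M rule: finite_induct)
  case empty
  then show ?case by simp
next
  case (insert k T)
  define q where "q X \<epsilon> = mixed_vol (\<lambda>j. if j \<in> T then K + (*\<^sub>R) \<epsilon> ` L else (M(k := X)) j)" for X \<epsilon>
  have zero: "K + (*\<^sub>R) 0 ` L = K"
  proof -
    have "(*\<^sub>R) 0 ` L = {0}" using L by (auto simp: compact_convex_def)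
    then show ?thesis by (simp only: set_add_0_right)
  qed
  have upd: "(\<lambda>j. if j \<in> T then Y else (M(k := X)) j) = (\<lambda>j. if j \<in> insert k T then Y else M j)(k := X)" for X Y
    by (rule ext) (use insert.hyps in simp)
  have split: "mixed_vol (\<lambda>j. if j \<in> insert k T then K + (*\<^sub>R) \<epsilon> ` L else M j) = q K \<epsilon> + \<epsilon> * q L \<epsilon>" if "0 \<le> \<epsilon>" for \<epsilon>
  proof -
    let ?F = "\<lambda>j. if j \<in> insert k T then K + (*\<^sub>R) \<epsilon> ` L else M j"
    have "mixed_vol (?F(k := (*\<^sub>R) 1 ` K + (*\<^sub>R) \<epsilon> ` L)) = 1 * mixed_vol (?F(k := K)) + \<epsilon> * mixed_vol (?F(k := L))"
      by (rule mixed_vol_linear) (simp_all add: K L insert.prems that compact_convex_plus compact_convex_scaleR)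
    moreover have "?F(k := (*\<^sub>R) 1 ` K + (*\<^sub>R) \<epsilon> ` L) = ?F" by (rule ext) simp
    ultimately show ?thesis unfolding q_def upd by (simp only: mult_1)
  qed
  have M_compact_convex: "compact_convex ((M(k := X)) j)" if "compact_convex X" for X j using insert.prems that by simp
  have dK: "(q K has_real_derivative (\<Sum>k'\<in>T. mixed_vol ((\<lambda>j. if j \<in> T then K else (M(k := K)) j)(k' := L)))) (at 0 within {0..})"
    unfolding q_def by (rule insert.IH) (rule M_compact_convex[OF K])
  have "(q L has_real_derivative (\<Sum>k'\<in>T. mixed_vol ((\<lambda>j. if j \<in> T then K else (M(k := L)) j)(k' := L)))) (at 0 within {0..})"
    unfolding q_def by (rule insert.IH) (rule M_compact_convex[OF L])
  then obtain d where dL: "(q L has_real_derivative d) (at 0 within {0..})" ..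
  have qK: "(\<lambda>j. if j \<in> T then K else (M(k := K)) j) = (\<lambda>j. if j \<in> insert k T then K else M j)"
    by (rule ext) simp
  have qL: "q L 0 = mixed_vol ((\<lambda>j. if j \<in> insert k T then K else M j)(k := L))"
    unfolding q_def zero upd ..
  have "((\<lambda>\<epsilon>. q K \<epsilon> + \<epsilon> * q L \<epsilon>) has_real_derivative
      (\<Sum>k'\<in>insert k T. mixed_vol ((\<lambda>j. if j \<in> insert k T then K else M j)(k' := L)))) (at 0 within {0..})"
    by (rule DERIV_cong[OF DERIV_add[OF dK[unfolded qK] DERIV_mult[OF DERIV_ident dL]]])
      (simp only: sum.insert[OF insert.hyps(1,2)] qL mult_1 mult_zero_right add_0_right add.commute)
  then show ?case
  proof (rule has_field_derivative_transform_within[where d = 1])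
    fix x :: real assume "x \<in> {0..}"
    then show "q K x + x * q L x = mixed_vol (\<lambda>j. if j \<in> insert k T then K + (*\<^sub>R) x ` L else M j)"
      by (intro split[symmetric]) simp
  qed simp_all
qed

lemma minkowski_first_variation:
  fixes K L :: "(real^'n) set"
  assumes K: "compact_convex K" and L: "compact_convex L"
  shows "((\<lambda>\<epsilon>. measure lebesgue (K + (*\<^sub>R) \<epsilon> ` L)) has_real_derivative
     CARD('n) * mixed_vol ((\<lambda>_. K)(k := L))) (at 0 within {0..})"
proof -
  have swap: "mixed_vol ((\<lambda>_. K)(k' := L)) = mixed_vol ((\<lambda>_. K)(k := L))" for k' :: 'n
  proof -
    have "(\<lambda>_. K)(k' := L) = ((\<lambda>_. K)(k := L)) \<circ> Transposition.transpose k k'"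
      by (auto simp: fun_eq_iff Transposition.transpose_def)
    moreover have "Transposition.transpose k k' permutes UNIV" by (rule permutes_swap_id) auto
    ultimately show ?thesis using mixed_vol_permute[of "(\<lambda>_. K)(k := L)"] K L by simp
  qed
  have "((\<lambda>\<epsilon>. mixed_vol (\<lambda>j :: 'n. K + (*\<^sub>R) \<epsilon> ` L)) has_real_derivative
     CARD('n) * mixed_vol ((\<lambda>_. K)(k := L))) (at 0 within {0..})"
  proof (rule DERIV_cong)
    show "((\<lambda>\<epsilon>. mixed_vol (\<lambda>j :: 'n. K + (*\<^sub>R) \<epsilon> ` L)) has_real_derivative
       (\<Sum>k'\<in>UNIV. mixed_vol ((\<lambda>_ :: 'n. K)(k' := L)))) (at 0 within {0..})"
      using mixed_vol_partial_right_derivative[OF K L K, of UNIV] by (simp only: UNIV_I if_True)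
    have "(\<Sum>k'\<in>UNIV. mixed_vol ((\<lambda>_ :: 'n. K)(k' := L))) = (\<Sum>k'\<in>(UNIV :: 'n set). mixed_vol ((\<lambda>_. K)(k := L)))"
      by (rule sum.cong[OF refl]) (rule swap)
    then show "(\<Sum>k'\<in>UNIV. mixed_vol ((\<lambda>_ :: 'n. K)(k' := L))) = CARD('n) * mixed_vol ((\<lambda>_. K)(k := L))"
      by (simp only: sum_constant)
  qed
  then show ?thesis
    by (simp add: mixed_vol_const compact_convex_plus compact_convex_scaleR K L)
qed

section \<open>Barycentric coordinates of a simplex\<close>

text \<open>
  Barycentric coordinates with respect to the vertices C: the coordinate of x at the vertex a is
  \<gamma> a x + \<beta> a, and the facet opposite to a is where it vanishes.
\<close>
definition simplex_coordinates ::
  "(real^'n) set \<Rightarrow> (real^'n) set \<Rightarrow> (real^'n \<Rightarrow> real^'n \<Rightarrow> real) \<Rightarrow> (real^'n \<Rightarrow> real) \<Rightarrow> bool" where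
  "simplex_coordinates K C \<gamma> \<beta> \<longleftrightarrow>
     finite C \<and> (\<forall>a. linear (\<gamma> a)) \<and>
     (\<forall>x. (\<Sum>a\<in>C. (\<gamma> a x + \<beta> a) *\<^sub>R a) = x) \<and>
     (\<forall>x. (\<Sum>a\<in>C. \<gamma> a x + \<beta> a) = 1) \<and>
     (\<forall>u. \<forall>a\<in>C. sum u C = 1 \<longrightarrow> \<gamma> a (\<Sum>b\<in>C. u b *\<^sub>R b) + \<beta> a = u a) \<and>
     K = {x. \<forall>a\<in>C. 0 \<le> \<gamma> a x + \<beta> a} \<and> compact_convex K"

lemma
  assumes "simplex_coordinates K C \<gamma> \<beta>"
  shows finite_vertices: "finite C"
    and linear_part: "linear (\<gamma> a)"
    and combination: "(\<Sum>a\<in>C. (\<gamma> a x + \<beta> a) *\<^sub>R a) = x"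
    and sum_one: "(\<Sum>a\<in>C. \<gamma> a x + \<beta> a) = 1"
    and unique: "sum u C = 1 \<Longrightarrow> a \<in> C \<Longrightarrow> \<gamma> a (\<Sum>b\<in>C. u b *\<^sub>R b) + \<beta> a = u a"
    and simplex_eq: "K = {x. \<forall>a\<in>C. 0 \<le> \<gamma> a x + \<beta> a}"
    and simplex_compact_convex: "compact_convex K"
  using assms unfolding simplex_coordinates_def by blast+

lemma simplex_coordinates_exist:
  fixes K :: "(real^'n) set"
  assumes "int CARD('n) simplex K"
  shows "\<exists>C \<gamma> \<beta>. simplex_coordinates K C \<gamma> \<beta>"
proof -
  obtain C where C: "\<not> affine_dependent C" "int (card C) = int CARD('n) + 1" "K = convex hull C"
    using assms unfolding simplex_def by blast
  have fin: "finite C" using C(1) by (rule aff_independent_finite)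
  have "aff_dim C = int (DIM(real^'n))"
    using aff_dim_affine_independent[OF C(1)] C(2) by simp
  then have "affine hull C = UNIV" by (rule affine_hull_UNIV)
  then have ex: "\<exists>u. sum u C = 1 \<and> (\<Sum>a\<in>C. u a *\<^sub>R a) = x" for x
    using affine_hull_finite[OF fin] by blast
  have uniq: "u a = v a"
    if "sum u C = sum v C" "(\<Sum>a\<in>C. u a *\<^sub>R a) = (\<Sum>a\<in>C. v a *\<^sub>R a)" "a \<in> C" for u v a
  proof (rule ccontr)
    assume "u a \<noteq> v a"
    then have "sum (\<lambda>a. u a - v a) C = 0 \<and> (\<exists>a\<in>C. u a - v a \<noteq> 0) \<and> (\<Sum>a\<in>C. (u a - v a) *\<^sub>R a) = 0"
      using that by (auto simp: sum_subtractf scaleR_diff_left)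
    then show False
      using C(1) affine_dependent_explicit_finite[OF fin] by blast
  qed
  define bary where "bary x = (SOME u. sum u C = 1 \<and> (\<Sum>a\<in>C. u a *\<^sub>R a) = x)" for x
  have bary: "sum (bary x) C = 1" "(\<Sum>a\<in>C. bary x a *\<^sub>R a) = x" for x
    using someI_ex[OF ex[of x]] unfolding bary_def by auto
  define \<beta> where "\<beta> = bary 0"
  define \<gamma> where "\<gamma> a x = (if a \<in> C then bary x a - \<beta> a else 0)" for a x
  have eq: "\<gamma> a x + \<beta> a = bary x a" if "a \<in> C" for a x using that by (simp add: \<gamma>_def)
  have bary_add: "bary (x + y) a = bary x a + bary y a - \<beta> a" if "a \<in> C" for x y a
    by (rule uniq[OF _ _ that])
      (simp_all add: sum_subtractf sum.distrib bary \<beta>_def scaleR_diff_left scaleR_add_left)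
  have bary_scale: "bary (r *\<^sub>R x) a = r * bary x a + (1 - r) * \<beta> a" if "a \<in> C" for r x a
  proof (rule uniq[OF _ _ that])
    show "sum (bary (r *\<^sub>R x)) C = (\<Sum>a\<in>C. r * bary x a + (1 - r) * \<beta> a)"
      by (simp add: sum.distrib sum_distrib_left[symmetric] bary \<beta>_def)
    have "(\<Sum>a\<in>C. (r * bary x a + (1 - r) * \<beta> a) *\<^sub>R a) =
       r *\<^sub>R (\<Sum>a\<in>C. bary x a *\<^sub>R a) + (1 - r) *\<^sub>R (\<Sum>a\<in>C. \<beta> a *\<^sub>R a)"
      by (simp add: scaleR_add_left sum.distrib scaleR_sum_right)
    then show "(\<Sum>a\<in>C. bary (r *\<^sub>R x) a *\<^sub>R a) = (\<Sum>a\<in>C. (r * bary x a + (1 - r) * \<beta> a) *\<^sub>R a)"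
      by (simp add: bary \<beta>_def)
  qed
  have "simplex_coordinates K C \<gamma> \<beta>"
    unfolding simplex_coordinates_def
  proof (intro conjI allI ballI impI)
    show "linear (\<gamma> a)" for a
      by (rule linearI) (auto simp: \<gamma>_def bary_add bary_scale algebra_simps)
    show "(\<Sum>a\<in>C. (\<gamma> a x + \<beta> a) *\<^sub>R a) = x" "(\<Sum>a\<in>C. \<gamma> a x + \<beta> a) = 1" for x
      using bary[of x] by (simp_all add: eq cong: sum.cong)
    show un: "\<gamma> a (\<Sum>b\<in>C. u b *\<^sub>R b) + \<beta> a = u a" if "a \<in> C" "sum u C = 1" for u a
      unfolding eq[OF that(1)] by (rule uniq[OF _ _ that(1)]) (simp_all add: bary that)
    show "K = {x. \<forall>a\<in>C. 0 \<le> \<gamma> a x + \<beta> a}"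
    proof (intro set_eqI iffI)
      fix x assume "x \<in> K"
      then obtain u where u: "\<forall>a\<in>C. 0 \<le> u a" "sum u C = 1" "(\<Sum>a\<in>C. u a *\<^sub>R a) = x"
        unfolding C(3) convex_hull_finite[OF fin] by blast
      then show "x \<in> {x. \<forall>a\<in>C. 0 \<le> \<gamma> a x + \<beta> a}" using un[OF _ u(2)] by auto
    next
      fix x assume "x \<in> {x. \<forall>a\<in>C. 0 \<le> \<gamma> a x + \<beta> a}"
      then have "\<forall>a\<in>C. 0 \<le> bary x a" by (simp add: eq)
      then show "x \<in> K" unfolding C(3) convex_hull_finite[OF fin] using bary[of x] by blast
    qed
    have "K \<noteq> {}" using assms by (auto simp del: of_nat_eq_iff)
    then show "compact_convex K" using convex_simplex[OF assms] compact_simplex[OF assms] by (simp add: compact_convex_def)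
  qed (rule fin)
  then show ?thesis by blast
qed

lemma sum_constant_part:
  assumes coords: "simplex_coordinates K C \<gamma> \<beta>"
  shows "sum \<beta> C = 1" "(\<Sum>a\<in>C. \<beta> a *\<^sub>R a) = 0"
  using sum_one[OF coords, of 0] combination[OF coords, of 0] by (simp_all add: linear_0[OF linear_part[OF coords]])

lemma sum_linear_part:
  assumes coords: "simplex_coordinates K C \<gamma> \<beta>"
  shows "(\<Sum>a\<in>C. \<gamma> a x) = 0" "(\<Sum>a\<in>C. \<gamma> a x *\<^sub>R a) = x"
  using sum_one[OF coords, of x] combination[OF coords, of x] sum_constant_part[OF coords]
  by (simp_all add: sum.distrib scaleR_add_left)

lemma linear_part_combination:
  assumes coords: "simplex_coordinates K C \<gamma> \<beta>"
    and "a \<in> C"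
  shows "\<gamma> a (\<Sum>b\<in>C. w b *\<^sub>R b) = w a - sum w C * \<beta> a"
proof -
  define u where "u b = w b + (1 - sum w C) * \<beta> b" for b
  have "sum u C = 1"
    by (simp add: u_def sum.distrib sum_distrib_left[symmetric] sum_constant_part[OF coords])
  moreover have "(\<Sum>b\<in>C. u b *\<^sub>R b) = (\<Sum>b\<in>C. w b *\<^sub>R b) + (1 - sum w C) *\<^sub>R (\<Sum>b\<in>C. \<beta> b *\<^sub>R b)"
    by (simp add: u_def scaleR_add_left sum.distrib scaleR_sum_right)
  ultimately have "\<gamma> a (\<Sum>b\<in>C. w b *\<^sub>R b) + \<beta> a = u a"
    using unique[OF coords, of u a] assms(2) by (simp add: sum_constant_part[OF coords])
  then show ?thesis by (simp add: u_def algebra_simps)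
qed

definition region ::
  "(real^'n) set \<Rightarrow> (real^'n \<Rightarrow> real^'n \<Rightarrow> real) \<Rightarrow> (real^'n \<Rightarrow> real) \<Rightarrow> (real^'n \<Rightarrow> real) \<Rightarrow> (real^'n) set" where
  "region C \<gamma> \<beta> c = {x. \<forall>a\<in>C. c a \<le> \<gamma> a x + \<beta> a}"

text \<open>
  Bounding all barycentric coordinates from below by c moves the facets in parallel, which yields a
  homothetic copy of K of ratio 1 - sum c.
\<close>
lemma region_eq_homothet:
  assumes coords: "simplex_coordinates K C \<gamma> \<beta>"
    and "sum c C \<le> 1"
  shows "region C \<gamma> \<beta> c = (\<lambda>x. (1 - sum c C) *\<^sub>R x + (\<Sum>a\<in>C. c a *\<^sub>R a)) ` K"
proof (intro set_eqI iffI)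
  define s where "s = 1 - sum c C"
  have s: "0 \<le> s" using assms by (simp add: s_def)
  fix y
  {
    assume "y \<in> (\<lambda>x. (1 - sum c C) *\<^sub>R x + (\<Sum>a\<in>C. c a *\<^sub>R a)) ` K"
    then obtain x where x: "x \<in> K" and y: "y = s *\<^sub>R x + (\<Sum>a\<in>C. c a *\<^sub>R a)" by (auto simp: s_def)
    have "c a \<le> \<gamma> a y + \<beta> a" if a: "a \<in> C" for a
    proof -
      have "\<gamma> a y + \<beta> a = s * (\<gamma> a x + \<beta> a) + c a"
        unfolding y linear_add[OF linear_part[OF coords]] linear_scale[OF linear_part[OF coords]] linear_part_combination[OF coords a]
        by (simp add: s_def algebra_simps)
      moreover have "0 \<le> \<gamma> a x + \<beta> a" using x a simplex_eq[OF coords] by blast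
      ultimately show ?thesis using s by simp
    qed
    then show "y \<in> region C \<gamma> \<beta> c" by (simp add: region_def)
  next
    assume "y \<in> region C \<gamma> \<beta> c"
    then have w: "0 \<le> \<gamma> a y + \<beta> a - c a" if "a \<in> C" for a using that by (auto simp: region_def)
    have ws: "(\<Sum>a\<in>C. \<gamma> a y + \<beta> a - c a) = s" using sum_one[OF coords, of y] by (simp add: sum_subtractf s_def)
    have y: "y = (\<Sum>a\<in>C. (\<gamma> a y + \<beta> a - c a) *\<^sub>R a) + (\<Sum>a\<in>C. c a *\<^sub>R a)"
      using combination[OF coords, of y] by (simp add: scaleR_diff_left sum_subtractf)
    have "\<exists>x\<in>K. (\<Sum>a\<in>C. (\<gamma> a y + \<beta> a - c a) *\<^sub>R a) = s *\<^sub>R x"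
    proof (cases "s = 0")
      case True
      then have "\<gamma> a y + \<beta> a - c a = 0" if "a \<in> C" for a
        using ws w that sum_nonneg_eq_0_iff[OF finite_vertices[OF coords], of "\<lambda>a. \<gamma> a y + \<beta> a - c a"] by auto
      then show ?thesis using True simplex_compact_convex[OF coords] by (auto simp: compact_convex_def)
    next
      case False
      define x where "x = (\<Sum>a\<in>C. ((\<gamma> a y + \<beta> a - c a) / s) *\<^sub>R a)"
      have "(\<Sum>a\<in>C. (\<gamma> a y + \<beta> a - c a) / s) = 1"
        using ws False by (simp add: sum_divide_distrib[symmetric])
      then have "\<gamma> a x + \<beta> a = (\<gamma> a y + \<beta> a - c a) / s" if "a \<in> C" for a
        unfolding x_def using unique[OF coords] that by blast
      then have "x \<in> K" using w s by (simp add: simplex_eq[OF coords])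
      moreover have "(\<Sum>a\<in>C. (\<gamma> a y + \<beta> a - c a) *\<^sub>R a) = s *\<^sub>R x"
        using False by (simp add: x_def scaleR_sum_right)
      ultimately show ?thesis by blast
    qed
    then obtain x where x: "x \<in> K" "(\<Sum>a\<in>C. (\<gamma> a y + \<beta> a - c a) *\<^sub>R a) = s *\<^sub>R x" by blast
    have "y = s *\<^sub>R x + (\<Sum>a\<in>C. c a *\<^sub>R a)" by (rule trans[OF y]) (simp only: x(2))
    with x(1) show "y \<in> (\<lambda>x. (1 - sum c C) *\<^sub>R x + (\<Sum>a\<in>C. c a *\<^sub>R a)) ` K" by (auto simp: s_def)
  }
qed

lemma
  fixes K :: "(real^'n) set"
  assumes coords: "simplex_coordinates K C \<gamma> \<beta>"
    and "sum c C \<le> 1"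
  shows lmeasurable_region: "region C \<gamma> \<beta> c \<in> lmeasurable"
    and measure_region: "measure lebesgue (region C \<gamma> \<beta> c) = (1 - sum c C) ^ CARD('n) * measure lebesgue K"
proof -
  have "compact ((\<lambda>x. (1 - sum c C) *\<^sub>R x + (\<Sum>a\<in>C. c a *\<^sub>R a)) ` K)"
    using simplex_compact_convex[OF coords] by (intro compact_continuous_image continuous_intros) (simp add: compact_convex_def)
  then show "region C \<gamma> \<beta> c \<in> lmeasurable"
    unfolding region_eq_homothet[OF coords assms(2)] by (rule lmeasurable_compact)
  show "measure lebesgue (region C \<gamma> \<beta> c) = (1 - sum c C) ^ CARD('n) * measure lebesgue K"
    unfolding region_eq_homothet[OF coords assms(2)] measure_lebesgue_affine using assms by simp
qed

text \<open>
  Z arises from region c by removing two smaller homothetic copies of K, whose intersection is again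
  such a copy. So its volume is a second difference of the n-th power with step r, of order r^2.
\<close>
lemma measure_region_near_two_facets:
  fixes K :: "(real^'n) set"
  assumes coords: "simplex_coordinates K C \<gamma> \<beta>"
    and ab: "a \<in> C" "b \<in> C" "a \<noteq> b" and r: "0 \<le> r" and s: "sum c C + 2 * r \<le> 1"
  defines "Z \<equiv> {x \<in> region C \<gamma> \<beta> c. \<gamma> a x + \<beta> a < c a + r \<and> \<gamma> b x + \<beta> b < c b + r}"
  shows "Z \<in> lmeasurable"
    and "measure lebesgue Z = ((1 - sum c C) ^ CARD('n) - 2 * (1 - sum c C - r) ^ CARD('n)
      + (1 - sum c C - 2 * r) ^ CARD('n)) * measure lebesgue K"
proof -
  define ca where "ca = c(a := c a + r)"
  define cb where "cb = c(b := c b + r)"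
  define cab where "cab = ca(b := c b + r)"
  have sum_upd: "sum (d(e := d e + r)) C = sum d C + r" if "e \<in> C" for d e
  proof -
    have "sum (d(e := d e + r)) C = (\<Sum>x\<in>C. d x + (if x = e then r else 0))"
      by (rule sum.cong) auto
    then show ?thesis using that finite_vertices[OF coords] by (simp add: sum.distrib)
  qed
  have sums: "sum ca C = sum c C + r" "sum cb C = sum c C + r" "sum cab C = sum c C + 2 * r"
    using sum_upd[OF ab(1), of c] sum_upd[OF ab(2), of c] sum_upd[OF ab(2), of ca] ab(3)
    by (simp_all add: ca_def cb_def cab_def)
  have le: "sum c C \<le> 1" "sum ca C \<le> 1" "sum cb C \<le> 1" "sum cab C \<le> 1"
    using r s by (simp_all add: sums)
  note meas = le[THEN lmeasurable_region[OF coords]]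
  have "cab e = max (ca e) (cb e)" for e
    using ab r by (simp add: ca_def cb_def cab_def)
  then have int: "region C \<gamma> \<beta> ca \<inter> region C \<gamma> \<beta> cb = region C \<gamma> \<beta> cab"
    by (auto simp: region_def)
  have "c e \<le> ca e" "c e \<le> cb e" for e
    using r by (simp_all add: ca_def cb_def)
  then have sub: "region C \<gamma> \<beta> ca \<union> region C \<gamma> \<beta> cb \<subseteq> region C \<gamma> \<beta> c"
    unfolding region_def by (blast intro: order_trans)
  have "x \<in> region C \<gamma> \<beta> ca \<longleftrightarrow> c a + r \<le> \<gamma> a x + \<beta> a" "x \<in> region C \<gamma> \<beta> cb \<longleftrightarrow> c b + r \<le> \<gamma> b x + \<beta> b"
    if "x \<in> region C \<gamma> \<beta> c" for x
    using that ab by (auto simp: region_def ca_def cb_def)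
  then have Z: "Z = region C \<gamma> \<beta> c - (region C \<gamma> \<beta> ca \<union> region C \<gamma> \<beta> cb)"
    unfolding Z_def by auto
  show "Z \<in> lmeasurable" unfolding Z using meas by (intro fmeasurable.Diff fmeasurable.Un) auto
  have "measure lebesgue Z = measure lebesgue (region C \<gamma> \<beta> c) - measure lebesgue (region C \<gamma> \<beta> ca \<union> region C \<gamma> \<beta> cb)"
    unfolding Z using meas by (intro measurable_measure_Diff sub) auto
  also have "measure lebesgue (region C \<gamma> \<beta> ca \<union> region C \<gamma> \<beta> cb) =
      measure lebesgue (region C \<gamma> \<beta> ca) + measure lebesgue (region C \<gamma> \<beta> cb) - measure lebesgue (region C \<gamma> \<beta> cab)"
    using measure_Un3[OF meas(2,3)] by (simp add: int)
  finally show "measure lebesgue Z = ((1 - sum c C) ^ CARD('n) - 2 * (1 - sum c C - r) ^ CARD('n)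
      + (1 - sum c C - 2 * r) ^ CARD('n)) * measure lebesgue K"
    unfolding le[THEN measure_region[OF coords]] sums by (simp add: algebra_simps)
qed

text \<open>
  With m a the minimum of \<gamma> a over L, the inequalities m a \<le> \<gamma> a x define a homothetic copy of K of
  ratio - sum m that contains L, and it is touched by L at q a in the facet opposite to a.
\<close>
lemma circumscribed_homothet:
  assumes coords: "simplex_coordinates K C \<gamma> \<beta>"
    and L: "compact_convex L"
  obtains t y m q where "0 \<le> t" "L \<subseteq> (*\<^sub>R) t ` K + {y}" "sum m C = - t"
    "\<And>a. a \<in> C \<Longrightarrow> q a \<in> L \<and> \<gamma> a (q a) = m a"
proof -
  have "\<exists>q\<in>L. \<forall>x\<in>L. \<gamma> a q \<le> \<gamma> a x" for a
    using L linear_part[OF coords, of a]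
    by (intro continuous_attains_inf linear_continuous_on) (auto simp: compact_convex_def linear_conv_bounded_linear)
  then have "\<forall>a. \<exists>q. q \<in> L \<and> (\<forall>x\<in>L. \<gamma> a q \<le> \<gamma> a x)" by blast
  from choice[OF this] obtain q where q': "\<forall>a. q a \<in> L \<and> (\<forall>x\<in>L. \<gamma> a (q a) \<le> \<gamma> a x)" ..
  then have q: "q a \<in> L" "\<And>x. x \<in> L \<Longrightarrow> \<gamma> a (q a) \<le> \<gamma> a x" for a by blast+
  define m where "m a = \<gamma> a (q a)" for a
  define t where "t = - sum m C"
  obtain x0 where "x0 \<in> L" using L by (auto simp: compact_convex_def)
  then have "sum m C \<le> (\<Sum>a\<in>C. \<gamma> a x0)" unfolding m_def by (intro sum_mono q)
  then have t: "0 \<le> t" by (simp add: t_def sum_linear_part[OF coords])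
  define y where "y = (\<Sum>a\<in>C. m a *\<^sub>R a)"
  have "x \<in> (*\<^sub>R) t ` K + {y}" if "x \<in> L" for x
  proof -
    define v where "v = (\<Sum>a\<in>C. (\<gamma> a x - m a) *\<^sub>R a)"
    have nn: "0 \<le> \<gamma> a x - m a" for a using q(2)[OF that] by (simp add: m_def)
    have vs: "(\<Sum>a\<in>C. \<gamma> a x - m a) = t" by (simp add: sum_subtractf sum_linear_part[OF coords] t_def)
    have "v \<in> (*\<^sub>R) t ` K"
    proof (cases "t = 0")
      case True
      then have "\<gamma> a x - m a = 0" if "a \<in> C" for a
        using vs nn that sum_nonneg_eq_0_iff[OF finite_vertices[OF coords], of "\<lambda>a. \<gamma> a x - m a"] by auto
      then have "v = 0" by (simp add: v_def)
      then show ?thesis using True simplex_compact_convex[OF coords] by (auto simp: compact_convex_def)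
    next
      case False
      define z where "z = (\<Sum>a\<in>C. ((\<gamma> a x - m a) / t) *\<^sub>R a)"
      have "(\<Sum>a\<in>C. (\<gamma> a x - m a) / t) = 1"
        using vs False by (simp add: sum_divide_distrib[symmetric])
      then have "\<gamma> a z + \<beta> a = (\<gamma> a x - m a) / t" if "a \<in> C" for a
        unfolding z_def using unique[OF coords] that by blast
      then have "z \<in> K" using nn t by (simp add: simplex_eq[OF coords])
      moreover have "v = t *\<^sub>R z" using False by (simp add: v_def z_def scaleR_sum_right)
      ultimately show ?thesis by blast
    qed
    moreover have "x = v + y"
      using sum_linear_part(2)[OF coords, of x] by (simp add: v_def y_def scaleR_diff_left sum_subtractf)
    ultimately show ?thesis using set_plus_intro[of v "(*\<^sub>R) t ` K" y "{y}"] by simp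
  qed
  then have "L \<subseteq> (*\<^sub>R) t ` K + {y}" by blast
  then show thesis
  proof (rule that[of t y m q, OF t])
    show "sum m C = - t" by (simp add: t_def)
  qed (use q in \<open>auto simp: m_def\<close>)
qed

text \<open>
  The region cut out by c = \<epsilon> m is (1 + \<epsilon> t) K + \<epsilon> y for the circumscribed copy t K + y of L.
  A point x of it outside all translates K + \<epsilon> q a fails, for every a, an inequality of K + \<epsilon> q a; the
  failing coordinate b is close to its lower bound, and it differs from a because q a lies in the
  facet of t K + y opposite to a. Doing this for some a and then again for the coordinate found yields two
  different facets close to x.
\<close>
lemma measure_simplex_plus_lower_bound:
  fixes K :: "(real^'n) set"
  assumes coords: "simplex_coordinates K C \<gamma> \<beta>"
    and L: "compact_convex L" and m: "sum m C = - t" "\<And>a. a \<in> C \<Longrightarrow> q a \<in> L \<and> \<gamma> a (q a) = m a"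
    and t: "0 \<le> t" and R: "0 \<le> R" "\<And>a b. a \<in> C \<Longrightarrow> b \<in> C \<Longrightarrow> \<gamma> b (q a) \<le> m b + R"
    and \<epsilon>: "0 \<le> \<epsilon>" "2 * \<epsilon> * R \<le> 1"
  shows "(1 + \<epsilon> * t) ^ CARD('n) * measure lebesgue K \<le> measure lebesgue (K + (*\<^sub>R) \<epsilon> ` L)
     + card {p \<in> C \<times> C. fst p \<noteq> snd p} * (((1 + \<epsilon> * t) ^ CARD('n) - 2 * (1 + \<epsilon> * (t - R)) ^ CARD('n)
        + (1 + \<epsilon> * (t - 2 * R)) ^ CARD('n)) * measure lebesgue K)"
proof -
  define c where "c a = \<epsilon> * m a" for a
  have sc: "sum c C = - (\<epsilon> * t)" by (simp add: c_def sum_distrib_left[symmetric] m)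
  have "0 \<le> \<epsilon> * t" using \<epsilon> t by simp
  then have sc1: "sum c C \<le> 1" "sum c C + 2 * (\<epsilon> * R) \<le> 1" using \<epsilon> unfolding sc by linarith+
  define P where "P = {p \<in> C \<times> C. fst p \<noteq> snd p}"
  define Z where "Z p = {x \<in> region C \<gamma> \<beta> c. \<gamma> (fst p) x + \<beta> (fst p) < c (fst p) + \<epsilon> * R \<and>
      \<gamma> (snd p) x + \<beta> (snd p) < c (snd p) + \<epsilon> * R}" for p
  define \<zeta> where "\<zeta> = ((1 + \<epsilon> * t) ^ CARD('n) - 2 * (1 + \<epsilon> * (t - R)) ^ CARD('n)
        + (1 + \<epsilon> * (t - 2 * R)) ^ CARD('n)) * measure lebesgue K"
  have finP: "finite P" unfolding P_def using finite_vertices[OF coords] by simp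
  have sizes: "1 - sum c C = 1 + \<epsilon> * t" "1 - sum c C - \<epsilon> * R = 1 + \<epsilon> * (t - R)"
    "1 - sum c C - 2 * (\<epsilon> * R) = 1 + \<epsilon> * (t - 2 * R)"
    by (simp_all add: sc algebra_simps)
  have Z: "Z p \<in> lmeasurable" "measure lebesgue (Z p) = \<zeta>" if "p \<in> P" for p
  proof -
    have p: "fst p \<in> C" "snd p \<in> C" "fst p \<noteq> snd p" using that by (auto simp: P_def)
    have "0 \<le> \<epsilon> * R" using \<epsilon> R by simp
    note near = measure_region_near_two_facets[OF coords p this sc1(2)]
    show "Z p \<in> lmeasurable" unfolding Z_def by (rule near(1))
    show "measure lebesgue (Z p) = \<zeta>" unfolding Z_def \<zeta>_def sizes[symmetric] by (rule near(2))
  qed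
  have cover: "region C \<gamma> \<beta> c \<subseteq> (K + (*\<^sub>R) \<epsilon> ` L) \<union> (\<Union>p\<in>P. Z p)"
  proof
    fix x assume x: "x \<in> region C \<gamma> \<beta> c"
    show "x \<in> (K + (*\<^sub>R) \<epsilon> ` L) \<union> (\<Union>p\<in>P. Z p)"
    proof (cases "\<exists>a\<in>C. \<forall>b\<in>C. \<epsilon> * \<gamma> b (q a) \<le> \<gamma> b x + \<beta> b")
      case True
      then obtain a where a: "a \<in> C" "\<And>b. b \<in> C \<Longrightarrow> \<epsilon> * \<gamma> b (q a) \<le> \<gamma> b x + \<beta> b" by blast
      have "x - \<epsilon> *\<^sub>R q a \<in> K"
        unfolding simplex_eq[OF coords] mem_Collect_eq linear_diff[OF linear_part[OF coords]] linear_scale[OF linear_part[OF coords]] real_scaleR_def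
      proof
        fix b assume "b \<in> C"
        from a(2)[OF this] show "0 \<le> \<gamma> b x - \<epsilon> * \<gamma> b (q a) + \<beta> b" by simp
      qed
      moreover have "\<epsilon> *\<^sub>R q a \<in> (*\<^sub>R) \<epsilon> ` L" using m(2)[OF a(1)] by blast
      ultimately have "(x - \<epsilon> *\<^sub>R q a) + \<epsilon> *\<^sub>R q a \<in> K + (*\<^sub>R) \<epsilon> ` L" by (rule set_plus_intro)
      then show ?thesis by simp
    next
      case False
      have far: "\<exists>b\<in>C. b \<noteq> a \<and> \<gamma> b x + \<beta> b < c b + \<epsilon> * R" if a: "a \<in> C" for a
      proof -
        have "\<not> (\<forall>b\<in>C. \<epsilon> * \<gamma> b (q a) \<le> \<gamma> b x + \<beta> b)" using False a by blast
        then obtain b where b: "b \<in> C" "\<gamma> b x + \<beta> b < \<epsilon> * \<gamma> b (q a)" by (auto simp: not_le)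
        have "c a \<le> \<gamma> a x + \<beta> a" using x a by (simp add: region_def)
        then have ba: "b \<noteq> a" using b m(2)[OF a] by (auto simp: c_def)
        have "\<epsilon> * \<gamma> b (q a) \<le> \<epsilon> * (m b + R)" using R(2)[OF a b(1)] \<epsilon>(1) by (rule mult_left_mono)
        then have "\<gamma> b x + \<beta> b < c b + \<epsilon> * R" using b(2) by (simp add: c_def distrib_left)
        then show ?thesis using b(1) ba by blast
      qed
      have "C \<noteq> {}" using sum_constant_part[OF coords] by auto
      then obtain a0 where "a0 \<in> C" by blast
      then obtain a where a: "a \<in> C" "\<gamma> a x + \<beta> a < c a + \<epsilon> * R" using far by blast
      then obtain b where b: "b \<in> C" "b \<noteq> a" "\<gamma> b x + \<beta> b < c b + \<epsilon> * R" using far by blast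
      have "(a, b) \<in> P" "x \<in> Z (a, b)" using a b x by (auto simp: P_def Z_def)
      then show ?thesis by blast
    qed
  qed
  have "compact_convex (K + (*\<^sub>R) \<epsilon> ` L)" by (intro compact_convex_plus compact_convex_scaleR simplex_compact_convex[OF coords] L)
  then have KL: "K + (*\<^sub>R) \<epsilon> ` L \<in> lmeasurable" by (simp add: compact_convex_def lmeasurable_compact)
  have UZ: "(\<Union>p\<in>P. Z p) \<in> lmeasurable" by (rule fmeasurable.finite_UN[OF finP]) (rule Z(1))
  have "(1 + \<epsilon> * t) ^ CARD('n) * measure lebesgue K = measure lebesgue (region C \<gamma> \<beta> c)"
    by (simp add: measure_region[OF coords sc1(1)] sc)
  also have "\<dots> \<le> measure lebesgue ((K + (*\<^sub>R) \<epsilon> ` L) \<union> (\<Union>p\<in>P. Z p))"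
    by (rule measure_mono_fmeasurable[OF cover]) (use KL UZ lmeasurable_region[OF coords sc1(1)] in auto)
  also have "\<dots> \<le> measure lebesgue (K + (*\<^sub>R) \<epsilon> ` L) + measure lebesgue (\<Union>p\<in>P. Z p)"
    by (rule measure_Un_le) (use KL UZ in auto)
  also have "measure lebesgue (\<Union>p\<in>P. Z p) \<le> (\<Sum>p\<in>P. measure lebesgue (Z p))"
    by (rule measure_UNION_le[OF finP]) (use Z in auto)
  also have "\<dots> = card P * \<zeta>" using Z by simp
  finally show ?thesis by (simp add: \<zeta>_def P_def)
qed

text \<open>
  Compare first derivatives at \<epsilon> = 0 in measure_simplex_plus_lower_bound, where both sides agree: the error term is a
  second difference and has derivative 0.
\<close>
lemma circumscribed_mixed_vol_ge:
  fixes K :: "(real^'n) set"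
  assumes coords: "simplex_coordinates K C \<gamma> \<beta>"
    and L: "compact_convex L" and m: "sum m C = - t" "\<And>a. a \<in> C \<Longrightarrow> q a \<in> L \<and> \<gamma> a (q a) = m a" and t: "0 \<le> t"
  shows "t * measure lebesgue K \<le> mixed_vol ((\<lambda>_. K)(k := L))"
proof -
  define R where "R = (\<Sum>a\<in>C. \<Sum>b\<in>C. \<bar>\<gamma> b (q a) - m b\<bar>)"
  have R0: "0 \<le> R" unfolding R_def by (intro sum_nonneg) simp
  have R: "\<gamma> b (q a) \<le> m b + R" if ab: "a \<in> C" "b \<in> C" for a b
  proof -
    have "\<bar>\<gamma> b (q a) - m b\<bar> \<le> (\<Sum>b\<in>C. \<bar>\<gamma> b (q a) - m b\<bar>)"
      using ab(2) finite_vertices[OF coords] by (intro member_le_sum) auto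
    also have "\<dots> \<le> R"
      unfolding R_def using ab(1) finite_vertices[OF coords]
      by (intro member_le_sum[where f = "\<lambda>a. \<Sum>b\<in>C. \<bar>\<gamma> b (q a) - m b\<bar>"]) (auto intro: sum_nonneg)
    finally show ?thesis by linarith
  qed
  define N where "N = real (card {p \<in> C \<times> C. fst p \<noteq> snd p})"
  define V where "V = measure lebesgue K"
  define F where "F \<epsilon> = measure lebesgue (K + (*\<^sub>R) \<epsilon> ` L)" for \<epsilon>
  define p where "p s \<epsilon> = (1 + \<epsilon> * s) ^ CARD('n)" for s \<epsilon> :: real
  define P where "P \<epsilon> = F \<epsilon> + N * ((p t \<epsilon> - 2 * p (t - R) \<epsilon> + p (t - 2 * R) \<epsilon>) * V) - p t \<epsilon> * V" for \<epsilon>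
  have dF: "(F has_real_derivative CARD('n) * mixed_vol ((\<lambda>_. K)(k := L))) (at 0 within {0..})"
    unfolding F_def by (rule minkowski_first_variation[OF simplex_compact_convex[OF coords] L])
  have dp: "(p s has_real_derivative CARD('n) * s) (at 0 within {0..})" for s :: real
    unfolding p_def by (auto intro!: derivative_eq_intros)
  have dP: "(P has_real_derivative CARD('n) * mixed_vol ((\<lambda>_. K)(k := L)) - CARD('n) * t * V) (at 0 within {0..})"
  proof -
    have "((\<lambda>\<epsilon>. p t \<epsilon> - 2 * p (t - R) \<epsilon> + p (t - 2 * R) \<epsilon>) has_real_derivative
        CARD('n) * t - 2 * (CARD('n) * (t - R)) + CARD('n) * (t - 2 * R)) (at 0 within {0..})"
      by (rule DERIV_add[OF DERIV_diff[OF dp[of t] DERIV_cmult[OF dp[of "t - R"], of 2]] dp[of "t - 2 * R"]])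
    then have "((\<lambda>\<epsilon>. p t \<epsilon> - 2 * p (t - R) \<epsilon> + p (t - 2 * R) \<epsilon>) has_real_derivative 0) (at 0 within {0..})"
      by (rule DERIV_cong) (simp add: algebra_simps)
    from DERIV_diff[OF DERIV_add[OF dF DERIV_cmult[OF DERIV_cmult_right[OF this]]] DERIV_cmult_right[OF dp[of t]],
        of N V V]
    show ?thesis unfolding P_def by simp
  qed
  have "(*\<^sub>R) 0 ` L = {0}" using L by (auto simp: compact_convex_def)
  then have "F 0 = V" by (simp only: F_def V_def set_add_0_right)
  then have P0: "P 0 = 0" by (simp add: P_def p_def)
  have P: "0 \<le> P \<epsilon>" if "0 \<le> \<epsilon>" "2 * \<epsilon> * R \<le> 1" for \<epsilon>
    using measure_simplex_plus_lower_bound[OF coords L m t R0 R that] by (simp add: P_def F_def V_def p_def N_def)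
  have "0 \<le> CARD('n) * mixed_vol ((\<lambda>_. K)(k := L)) - CARD('n) * t * V"
  proof (rule ccontr)
    assume "\<not> ?thesis"
    then obtain d where d: "d > 0" "\<And>h. 0 < h \<Longrightarrow> h < d \<Longrightarrow> P h < P 0"
      using has_real_derivative_neg_dec_right[OF dP] by (auto simp: not_le)
    \<comment> \<open>R + 1 rather than R, since R may be 0\<close>
    define h where "h = min (d / 2) (1 / (2 * (R + 1)))"
    have h: "0 < h" "h < d" "h \<le> 1 / (2 * (R + 1))" using d R0 by (auto simp: h_def)
    have "2 * h * R \<le> 2 * (1 / (2 * (R + 1))) * R"
      using h R0 by (intro mult_right_mono mult_left_mono) auto
    also have "\<dots> \<le> 1" using R0 by (simp add: field_simps)
    finally have "0 \<le> P h" using h by (intro P) auto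
    then show False using d(2)[OF h(1,2)] P0 by simp
  qed
  then have "CARD('n) * (t * V) \<le> CARD('n) * mixed_vol ((\<lambda>_. K)(k := L))" by (simp add: mult.assoc)
  then show ?thesis by (simp add: V_def)
qed

section \<open>The inequality for simplices\<close>

lemma mixed_vol_simplex_inequality:
  fixes F :: "'n::finite \<Rightarrow> (real^'n) set"
  assumes K: "int CARD('n) simplex K" and F: "\<And>k. compact_convex (F k)"
  shows "mixed_vol F * measure lebesgue K \<le> mixed_vol ((\<lambda>_. K)(k := F k)) * mixed_vol (F(k := K))"
proof -
  obtain C \<gamma> \<beta> where coords: "simplex_coordinates K C \<gamma> \<beta>" using simplex_coordinates_exist[OF K] by blast
  note simplex_compact_convex = simplex_compact_convex[OF coords]
  obtain t y m q where t: "0 \<le> t" and sub: "F k \<subseteq> (*\<^sub>R) t ` K + {y}" and m: "sum m C = - t"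
    and q: "\<And>a. a \<in> C \<Longrightarrow> q a \<in> F k \<and> \<gamma> a (q a) = m a"
    by (rule circumscribed_homothet[OF coords F[of k]]) (rule that)
  have one: "(*\<^sub>R) 1 ` {y} = {y}" by simp
  have "mixed_vol (F(k := F k)) \<le> mixed_vol (F(k := (*\<^sub>R) t ` K + (*\<^sub>R) 1 ` {y}))"
    unfolding one by (rule mixed_vol_mono[OF F F compact_convex_plus[OF compact_convex_scaleR[OF simplex_compact_convex] compact_convex_singleton] sub])
  also have "\<dots> = t * mixed_vol (F(k := K)) + 1 * mixed_vol (F(k := {y}))"
    by (rule mixed_vol_linear[OF F simplex_compact_convex compact_convex_singleton t]) simp
  also have "mixed_vol (F(k := {y})) = 0" by (rule mixed_vol_singleton[OF F])
  finally have "mixed_vol F \<le> t * mixed_vol (F(k := K))"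
    by (simp only: fun_upd_triv mult_zero_right add_0_right)
  then have "mixed_vol F * measure lebesgue K \<le> t * mixed_vol (F(k := K)) * measure lebesgue K"
    by (rule mult_right_mono) simp
  also have "\<dots> = (t * measure lebesgue K) * mixed_vol (F(k := K))" by simp
  also have "\<dots> \<le> mixed_vol ((\<lambda>_. K)(k := F k)) * mixed_vol (F(k := K))"
    by (intro mult_right_mono circumscribed_mixed_vol_ge[OF coords F m q t] mixed_vol_nonneg) (simp_all add: F simplex_compact_convex)
  finally show ?thesis .
qed

theorem mainTheorem2:
  fixes K :: "(real^'n) set" and L :: "nat \<Rightarrow> (real^'n) set"
  assumes "int CARD('n) simplex K"
    and "\<forall>i\<in>{1..CARD('n)}. convex_body (L i)"
  shows "mixed_volume (map L [1..<CARD('n) + 1]) * measure lebesgue K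
    \<le> mixed_volume (L 1 # replicate (CARD('n) - 1) K)
        * mixed_volume (map L [2..<CARD('n) + 1] @ [K])"
proof -
  define n where "n = CARD('n)"
  have n: "1 \<le> n" by (simp add: n_def Suc_le_eq)
  have K: "compact_convex K"
    using convex_simplex[OF assms(1)] compact_simplex[OF assms(1)] assms(1) by (auto simp: compact_convex_def)
  have L: "compact_convex (L i)" if "1 \<le> i" "i \<le> n" for i
  proof -
    have "convex_body (L i)" using assms(2) that by (simp add: n_def)
    then show ?thesis by (auto simp: convex_body_def compact_convex_def)
  qed
  define k where "k = (index_of_slot 0 :: 'n)"
  have k: "slot k = 0" unfolding k_def by (rule slot_index_of_slot) simp
  have slot_k: "slot j = 0 \<longleftrightarrow> j = k" for j using slot_eq_iff k by metis
  define F where "F j = L (slot j + 1)" for j :: 'n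
  have less: "slot (j :: 'n) < n" for j unfolding n_def by (rule slot_less)
  have F: "compact_convex (F j)" for j unfolding F_def using less[of j] by (intro L) auto
  have "mixed_volume (map L [1..<n + 1]) = mixed_vol F"
  proof -
    have "map L [1..<n + 1] \<in> compact_convex_tuples"
      using L by (auto simp: tuples_iff n_def)
    then have "mixed_volume (map L [1..<n + 1]) = mixed_vol (\<lambda>j. map L [1..<n + 1] ! slot j)"
      by (simp only: mixed_volume_eq_mixed_vol_list mixed_vol_list_def)
    also have "(\<lambda>j. map L [1..<n + 1] ! slot j) = F"
      by (rule ext) (simp add: F_def less del: upt_Suc)
    finally show ?thesis .
  qed
  moreover have "mixed_volume (L 1 # replicate (n - 1) K) = mixed_vol ((\<lambda>_. K)(k := F k))"
  proof -
    have "L 1 # replicate (n - 1) K \<in> compact_convex_tuples"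
      using L[of 1] n K by (auto simp: tuples_iff n_def)
    then have "mixed_volume (L 1 # replicate (n - 1) K) = mixed_vol (\<lambda>j. (L 1 # replicate (n - 1) K) ! slot j)"
      by (simp only: mixed_volume_eq_mixed_vol_list mixed_vol_list_def)
    also have "(\<lambda>j. (L 1 # replicate (n - 1) K) ! slot j) = (\<lambda>_. K)(k := F k)"
    proof
      fix j show "(L 1 # replicate (n - 1) K) ! slot j = ((\<lambda>_. K)(k := F k)) j"
        using less[of j] slot_k[of j] k by (auto simp: F_def nth_Cons')
    qed
    finally show ?thesis .
  qed
  moreover have "mixed_volume (map L [2..<n + 1] @ [K]) = mixed_vol (F(k := K))"
  proof -
    have tup: "K # map L [2..<n + 1] \<in> compact_convex_tuples" "map L [2..<n + 1] @ [K] \<in> compact_convex_tuples"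
      using L K n unfolding tuples_iff n_def[symmetric] by auto
    have "mixed_volume (map L [2..<n + 1] @ [K]) = mixed_vol_list (K # map L [2..<n + 1])"
      unfolding mixed_volume_eq_mixed_vol_list[OF tup(2)]
      by (rule mixed_vol_list_cong_mset[OF tup(1)]) simp
    also have "\<dots> = mixed_vol (\<lambda>j. (K # map L [2..<n + 1]) ! slot j)" by (simp only: mixed_vol_list_def)
    also have "(\<lambda>j. (K # map L [2..<n + 1]) ! slot j) = F(k := K)"
    proof
      fix j show "(K # map L [2..<n + 1]) ! slot j = (F(k := K)) j"
        using less[of j] slot_k[of j] k by (auto simp: F_def nth_Cons' simp del: upt_Suc)
    qed
    finally show ?thesis .
  qed
  ultimately show ?thesis
    using mixed_vol_simplex_inequality[OF assms(1), of F k] F by (simp add: n_def)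
qed

end
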